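(* Let $(G,\sigma)$ be a connection graph with $d$-dimensional signature $\sigma$, let $1\le\rho\le d$ be the dimension of the kernel of $\mathcal{L}^\sigma$, and let $\tau$ be the absolutely inconsistent component of $\sigma$, i.e. a $(d-\rho)$-dimensional signature with $\mathcal{L}^\tau$ invertible and $\sigma\cong(\bigoplus_{l=1}^{\rho}\iota^1)\oplus\tau$. Then for distinct $i,j\in V$, $$r^\sigma_{ij}=\frac{\rho}{d}\,r_{ij}+\frac{1}{2d}\operatorname{Tr}\Big((\mathcal{C}^\tau_{ii})^{-1}+(\mathcal{C}^\tau_{jj})^{-1}\Big).$$
   Context: $G=(V,E,W)$ finite connected weighted graph, $V=\{1,\dots,n\}$, $w_{xy}>0$ iff $\{x,y\}\in E$, $\deg(x)=\sum_yw_{xy}$. A $d$-dimensional signature maps oriented edges to $\mathsf{O}(d)$ with $\sigma_{yx}=\sigma_{xy}^{\mathrm T}$. Connection Laplacian $\mathcal{L}^\sigma$: $nd\times nd$ block matrix with blocks $\deg(x)I_d$ on the diagonal, $-w_{xy}\sigma_{xy}$ for $x\sim y$, $0$ otherwise. $\sigma\cong\tau'$ means there is $f:V\to\mathsf{O}(d)$ with $f(x)\sigma_{xy}=\tau'_{xy}f(y)$; $\oplus$ is edgewise block-diagonal sum; $\iota^1$ is the $1$-dimensional signature identically $1$. For $M=\begin{bmatrix}A&B\\C&D\end{bmatrix}$, $M/D=A-BD^\dagger C$; conductance matrix $\mathcal{C}^\tau(i,j)=\mathcal{L}^\tau/\mathcal{L}^\tau_{\{i,j\}^c,\{i,j\}^c}$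 with diagonal blocks $\mathcal{C}^\tau_{ii},\mathcal{C}^\tau_{jj}$. $r_{ij}=(e_i-e_j)^{\mathrm T}L^\dagger(e_i-e_j)$ with $L=D-W$ the graph Laplacian. $\Omega^0_{ij}=\mathbb{E}[\prod_{\ell=1}^{T^0_j}\sigma_{X_{\ell-1}X_\ell}\mid X_0=i]$ for the simple random walk with transition probabilities $w_{xy}/\deg(x)$, $T^0_j=\inf\{t\ge0:X_t=j\}$. $N_{ij}$: $nd\times d$ block column with $I_d$ at node $i$, $-(\Omega^0_{ij})^{\mathrm T}$ at node $j$, $0$ elsewhere; $\mathcal{W}_{i\to j}=(\mathcal{L}^\sigma)^\dagger N_{ij}$. Connection effective resistance: $r^\sigma_{ij}=\frac{1}{2d}\operatorname{Tr}\big(\mathcal{W}_{i\to j}^{\mathrm T}\mathcal{L}^\sigma\mathcal{W}_{i\to j}+\mathcal{W}_{j\to i}^{\mathrm T}\mathcal{L}^\sigma\mathcal{W}_{j\to i}\big)$. (If $\rho=d$, $\tau$ is $0$-dimensional and its trace term is $0$.) *)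

theory Defs
  imports Complex_Main "Jordan_Normal_Form.Matrix_Kernel" "Jordan_Normal_Form.DL_Submatrix"
begin

(* Vertices are 0..<n; weights w :: nat => nat => real; matrices are JNF real matrices.
   Node x, component a < d, corresponds to row/column index x*d + a. *)

definition wgraph :: "nat \<Rightarrow> (nat \<Rightarrow> nat \<Rightarrow> real) \<Rightarrow> bool" where
  "wgraph n w \<longleftrightarrow> 1 \<le> n \<and> (\<forall>x y. 0 \<le> w x y \<and> w x y = w y x) \<and> (\<forall>x. w x x = 0)
     \<and> (\<forall>x y. (x \<ge> n \<or> y \<ge> n) \<longrightarrow> w x y = 0)
     \<and> (\<forall>x<n. \<forall>y<n. (\<lambda>a b. a < n \<and> b < n \<and> 0 < w a b)\<^sup>*\<^sup>* x y)"

definition deg :: "nat \<Rightarrow> (nat \<Rightarrow> nat \<Rightarrow> real) \<Rightarrow> nat \<Rightarrow> real" where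
  "deg n w x = (\<Sum>y<n. w x y)"

definition orth :: "nat \<Rightarrow> real mat \<Rightarrow> bool" where
  "orth d A \<longleftrightarrow> A \<in> carrier_mat d d \<and> A * transpose_mat A = 1\<^sub>m d"

definition signature :: "nat \<Rightarrow> nat \<Rightarrow> (nat \<Rightarrow> nat \<Rightarrow> real) \<Rightarrow> (nat \<Rightarrow> nat \<Rightarrow> real mat) \<Rightarrow> bool" where
  "signature n d w \<sigma> \<longleftrightarrow> (\<forall>x<n. \<forall>y<n. 0 < w x y \<longrightarrow> orth d (\<sigma> x y) \<and> \<sigma> y x = transpose_mat (\<sigma> x y))"

definition conn_lap :: "nat \<Rightarrow> nat \<Rightarrow> (nat \<Rightarrow> nat \<Rightarrow> real) \<Rightarrow> (nat \<Rightarrow> nat \<Rightarrow> real mat) \<Rightarrow> real mat" where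
  "conn_lap n d w \<sigma> = mat (n*d) (n*d) (\<lambda>(r,c).
      let x = r div d; a = r mod d; y = c div d; b = c mod d in
      if x = y then (if a = b then deg n w x else 0)
      else (if 0 < w x y then - w x y * (\<sigma> x y $$ (a,b)) else 0))"

definition graph_lap :: "nat \<Rightarrow> (nat \<Rightarrow> nat \<Rightarrow> real) \<Rightarrow> real mat" where
  "graph_lap n w = mat n n (\<lambda>(x,y). (if x = y then deg n w x else 0) - w x y)"

definition pinv :: "real mat \<Rightarrow> real mat" where
  "pinv A = (THE X. X \<in> carrier_mat (dim_col A) (dim_row A) \<and> A * X * A = A \<and> X * A * X = X
              \<and> transpose_mat (A * X) = A * X \<and> transpose_mat (X * A) = X * A)"

definition minv :: "real mat \<Rightarrow> real mat" where
  "minv A = (THE B. B \<in> carrier_mat (dim_row A) (dim_row A) \<and> A * B = 1\<^sub>m (dim_row A) \<and> B * A = 1\<^sub>m (dim_row A))"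

definition mtrace :: "real mat \<Rightarrow> real" where
  "mtrace A = (\<Sum>i<dim_row A. A $$ (i,i))"

definition eff_res :: "nat \<Rightarrow> (nat \<Rightarrow> nat \<Rightarrow> real) \<Rightarrow> nat \<Rightarrow> nat \<Rightarrow> real" where
  "eff_res n w i j = (let e = unit_vec n i - unit_vec n j in e \<bullet> (pinv (graph_lap n w) *\<^sub>v e))"

definition hit_paths :: "nat \<Rightarrow> nat \<Rightarrow> nat \<Rightarrow> nat \<Rightarrow> nat list set" where
  "hit_paths n i j t = {ps. length ps = Suc t \<and> set ps \<subseteq> {..<n} \<and> hd ps = i \<and> last ps = j
                           \<and> j \<notin> set (butlast ps)}"

fun walk_prob :: "nat \<Rightarrow> (nat \<Rightarrow> nat \<Rightarrow> real) \<Rightarrow> nat list \<Rightarrow> real" where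
  "walk_prob n w (x # y # ps) = w x y / deg n w x * walk_prob n w (y # ps)"
| "walk_prob n w _ = 1"

fun path_prod :: "nat \<Rightarrow> (nat \<Rightarrow> nat \<Rightarrow> real mat) \<Rightarrow> nat list \<Rightarrow> real mat" where
  "path_prod d \<sigma> (x # y # ps) = \<sigma> x y * path_prod d \<sigma> (y # ps)"
| "path_prod d \<sigma> _ = 1\<^sub>m d"

(* Omega^0_{ij} = E[ prod_{l=1}^{T_j} sigma_{X_{l-1} X_l} | X_0 = i ], written out entrywise
   as the series over the hitting time T_j = t of the sum over the corresponding paths *)
definition Omega :: "nat \<Rightarrow> nat \<Rightarrow> (nat \<Rightarrow> nat \<Rightarrow> real) \<Rightarrow> (nat \<Rightarrow> nat \<Rightarrow> real mat) \<Rightarrow> nat \<Rightarrow> nat \<Rightarrow> real mat" where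
  "Omega n d w \<sigma> i j = mat d d (\<lambda>(a,b).
      \<Sum>t. \<Sum>ps\<in>hit_paths n i j t. walk_prob n w ps * (path_prod d \<sigma> ps $$ (a,b)))"

definition Nmat :: "nat \<Rightarrow> nat \<Rightarrow> (nat \<Rightarrow> nat \<Rightarrow> real) \<Rightarrow> (nat \<Rightarrow> nat \<Rightarrow> real mat) \<Rightarrow> nat \<Rightarrow> nat \<Rightarrow> real mat" where
  "Nmat n d w \<sigma> i j = mat (n*d) d (\<lambda>(r,c).
      if r div d = i then (1\<^sub>m d) $$ (r mod d, c)
      else if r div d = j then - (transpose_mat (Omega n d w \<sigma> i j) $$ (r mod d, c))
      else 0)"

definition Wmat :: "nat \<Rightarrow> nat \<Rightarrow> (nat \<Rightarrow> nat \<Rightarrow> real) \<Rightarrow> (nat \<Rightarrow> nat \<Rightarrow> real mat) \<Rightarrow> nat \<Rightarrow> nat \<Rightarrow> real mat" where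
  "Wmat n d w \<sigma> i j = pinv (conn_lap n d w \<sigma>) * Nmat n d w \<sigma> i j"

definition conn_res :: "nat \<Rightarrow> nat \<Rightarrow> (nat \<Rightarrow> nat \<Rightarrow> real) \<Rightarrow> (nat \<Rightarrow> nat \<Rightarrow> real mat) \<Rightarrow> nat \<Rightarrow> nat \<Rightarrow> real" where
  "conn_res n d w \<sigma> i j = (let L = conn_lap n d w \<sigma>; Wij = Wmat n d w \<sigma> i j; Wji = Wmat n d w \<sigma> j i in
      1 / (2 * real d) * mtrace (transpose_mat Wij * L * Wij + transpose_mat Wji * L * Wji))"

definition schur_keep :: "real mat \<Rightarrow> nat set \<Rightarrow> real mat" where
  "schur_keep M S = (let T = {..<dim_row M} - S in
      submatrix M S S - submatrix M S T * pinv (submatrix M T T) * submatrix M T S)"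

definition node_idx :: "nat \<Rightarrow> nat \<Rightarrow> nat set" where
  "node_idx d x = {x*d..<x*d+d}"

definition cond_mat :: "nat \<Rightarrow> nat \<Rightarrow> (nat \<Rightarrow> nat \<Rightarrow> real) \<Rightarrow> (nat \<Rightarrow> nat \<Rightarrow> real mat) \<Rightarrow> nat \<Rightarrow> nat \<Rightarrow> real mat" where
  "cond_mat n d w \<tau> i j = schur_keep (conn_lap n d w \<tau>) (node_idx d i \<union> node_idx d j)"

(* the diagonal block of C^tau(i,j) belonging to node i (rows/columns are ordered increasingly) *)
definition cond_block :: "nat \<Rightarrow> nat \<Rightarrow> (nat \<Rightarrow> nat \<Rightarrow> real) \<Rightarrow> (nat \<Rightarrow> nat \<Rightarrow> real mat) \<Rightarrow> nat \<Rightarrow> nat \<Rightarrow> real mat" where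
  "cond_block n d w \<tau> i j = (let C = cond_mat n d w \<tau> i j; off = (if i < j then 0 else d) in
      mat d d (\<lambda>(a,b). C $$ (off + a, off + b)))"

definition sig_equiv :: "nat \<Rightarrow> nat \<Rightarrow> (nat \<Rightarrow> nat \<Rightarrow> real) \<Rightarrow> (nat \<Rightarrow> nat \<Rightarrow> real mat) \<Rightarrow> (nat \<Rightarrow> nat \<Rightarrow> real mat) \<Rightarrow> bool" where
  "sig_equiv n d w \<sigma> \<tau>' \<longleftrightarrow> (\<exists>f. (\<forall>x<n. orth d (f x)) \<and>
      (\<forall>x<n. \<forall>y<n. 0 < w x y \<longrightarrow> f x * \<sigma> x y = \<tau>' x y * f y))"

definition triv_plus :: "nat \<Rightarrow> nat \<Rightarrow> (nat \<Rightarrow> nat \<Rightarrow> real mat) \<Rightarrow> nat \<Rightarrow> nat \<Rightarrow> real mat" where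
  "triv_plus \<rho> k \<tau> x y = four_block_mat (1\<^sub>m \<rho>) (0\<^sub>m \<rho> k) (0\<^sub>m k \<rho>) (\<tau> x y)"

end

theory Submission
  imports Defs
begin

text \<open>
  Let \<open>V\<close> be the matrix-valued potential with \<open>V(j) = 0\<close> and \<open>L V = I\<close> at \<open>i\<close>, \<open>L V = 0\<close> at the
  other nodes except \<open>j\<close>. Since \<open>x \<mapsto> \<Omega>\<^sub>x\<^sub>j\<close> is harmonic off \<open>j\<close>, symmetry of \<open>L\<close> forces
  \<open>L V = - \<Omega>\<^sub>i\<^sub>j\<^sup>T\<close> at \<open>j\<close>, so that \<open>L V = N\<^sub>i\<^sub>j\<close>. As \<open>N\<^sub>i\<^sub>j\<close> thus lies in the range of \<open>L\<close>, the energy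
  of \<open>W = L\<^sup>+ N\<^sub>i\<^sub>j\<close> is the trace of \<open>N\<^sub>i\<^sub>j\<^sup>T V\<close>, i.e. the trace of \<open>V(i)\<close>. Up to the gauge
  transformation \<open>f\<close>, which preserves that trace, \<open>V\<close> is block diagonal: each trivial component
  contributes the scalar potential, whose value at \<open>i\<close> is \<open>r\<^sub>i\<^sub>j\<close>, and \<open>\<tau>\<close> contributes the inverse of
  \<open>C\<^sub>i\<^sub>i\<close>, because the Schur complement maps boundary values at \<open>{i,j}\<close> to currents.
\<close>

section \<open>Pseudoinverses of symmetric matrices\<close>

text \<open>Neither \<open>pinv\<close> of the connection Laplacian L nor \<open>Omega\<close> is
  ever computed. \<open>Omega\<close> enters through two properties only: it is the identity at j
  and harmonic elsewhere. Harmonicity requires convergence of its defining series, which is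
  dominated by the hitting probabilities. The pseudoinverse enters through L L^+ L = L and the
  symmetry of L: L^+ N and V may differ, but only by a kernel element, which the energy does not
  see. All solvability questions (invertibility of the interior block, invertibility of C_ii, the
  kernel of the scalar Laplacian) have one source: the Dirichlet form is a sum of squares over
  edges. If at each entry either the function or its current vanishes, the energy is 0 and the
  function is parallel along every edge. The inverse of C_ii appears because values G at i and 0 at
  j produce the current C_ii G at i, so unit current forces C_ii G = I.\<close>

lemma injective_mat_inverse:
  fixes A :: "real mat"
  assumes A: "A \<in> carrier_mat n n"
    and inj: "\<And>v. v \<in> carrier_vec n \<Longrightarrow> A *\<^sub>v v = 0\<^sub>v n \<Longrightarrow> v = 0\<^sub>v n"
  obtains B where "B \<in> carrier_mat n n" "A * B = 1\<^sub>m n" "B * A = 1\<^sub>m n"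
proof -
  have "det A \<noteq> 0"
    using det_0_iff_vec_prod_zero_field[OF A] inj by blast
  from det_non_zero_imp_unit[OF A this, of n] that show ?thesis
    by (auto simp: Units_def ring_mat_def)
qed

lemma scalar_prod_mult_mat_vec:
  fixes A :: "real mat"
  assumes "A \<in> carrier_mat n m" "v \<in> carrier_vec n" "u \<in> carrier_vec m"
  shows "v \<bullet> (A *\<^sub>v u) = (transpose_mat A *\<^sub>v v) \<bullet> u"
  using assms transpose_vec_mult_scalar[of A n m u v] by (metis comm_scalar_prod mult_mat_vec_carrier transpose_carrier_mat)

lemma real_scalar_prod_self_zero:
  fixes v :: "real vec"
  assumes "v \<in> carrier_vec n" "v \<bullet> v = 0"
  shows "v = 0\<^sub>v n"
proof (rule eq_vecI)
  have *: "(\<Sum>k\<in>{0..<n}. v $ k * v $ k) = 0" using assms by (simp add: scalar_prod_def)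
  have "\<forall>k\<in>{0..<n}. v $ k * v $ k = 0"
    using sum_nonneg_eq_0_iff[of "{0..<n}" "\<lambda>k. v $ k * v $ k"] * by simp
  then show "\<And>i. i < dim_vec (0\<^sub>v n) \<Longrightarrow> v $ i = 0\<^sub>v n $ i" by simp
qed (use assms in simp)

text \<open>The matrix \<open>Q\<close> below is \<open>B B\<^sup>T\<close> for a matrix \<open>B\<close> whose columns form a basis of the kernel.\<close>
lemma symmetric_kernel_complement:
  fixes A :: "real mat"
  assumes A: "A \<in> carrier_mat n n" and sym: "transpose_mat A = A"
  obtains Q where "Q \<in> carrier_mat n n" "transpose_mat Q = Q" "A * Q = 0\<^sub>m n n"
    "\<And>v. v \<in> carrier_vec n \<Longrightarrow> (A + Q) *\<^sub>v v = 0\<^sub>v n \<Longrightarrow> v = 0\<^sub>v n"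
proof -
  interpret kernel n n A by unfold_locales (rule A)
  obtain K where finK: "finite K" and K: "kernel.basis n A K"
    using kernel_basis_exists[OF A] by blast
  have KA: "K \<subseteq> mat_kernel A" and spanK: "span K = mat_kernel A"
    using K by (auto simp: Ker.basis_def)
  have Kc: "x \<in> carrier_vec n" "A *\<^sub>v x = 0\<^sub>v n" if "x \<in> K" for x
    using KA mat_kernelD[OF A] that by auto
  define Q where "Q = mat n n (\<lambda>(r,c). \<Sum>x\<in>K. x $ r * x $ c)"
  have Q: "Q \<in> carrier_mat n n" by (simp add: Q_def)
  have QT: "transpose_mat Q = Q" by (rule eq_matI) (auto simp: Q_def mult.commute)
  have AQ: "A * Q = 0\<^sub>m n n"
  proof (rule eq_matI)
    fix r c assume rc: "r < dim_row (0\<^sub>m n n)" "c < dim_col (0\<^sub>m n n)"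
    have "(A * Q) $$ (r, c) = (\<Sum>k<n. \<Sum>x\<in>K. A $$ (r,k) * x $ k * x $ c)"
      using rc A Q by (simp add: scalar_prod_def Q_def sum_distrib_left mult.assoc lessThan_atLeast0)
    also have "\<dots> = (\<Sum>x\<in>K. (A *\<^sub>v x) $ r * x $ c)"
      using rc A carrier_vecD[OF Kc(1)]
      by (subst sum.swap) (auto intro!: sum.cong simp: scalar_prod_def sum_distrib_right lessThan_atLeast0)
    also have "\<dots> = 0" using rc Kc(2) by simp
    finally show "(A * Q) $$ (r, c) = 0\<^sub>m n n $$ (r, c)" using rc by simp
  qed (use A Q in auto)
  have "v = 0\<^sub>v n" if v: "v \<in> carrier_vec n" and AQv: "(A + Q) *\<^sub>v v = 0\<^sub>v n" for v
  proof -
    have sum0: "A *\<^sub>v v + Q *\<^sub>v v = 0\<^sub>v n"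
      using AQv add_mult_distrib_mat_vec[OF A Q v] by simp
    have Av: "A *\<^sub>v v \<in> carrier_vec n" and Qv: "Q *\<^sub>v v \<in> carrier_vec n" using A Q v by auto
    have AQv0: "A *\<^sub>v (Q *\<^sub>v v) = 0\<^sub>v n"
      using assoc_mult_mat_vec[OF A Q v, symmetric] v unfolding AQ by (intro eq_vecI) (auto simp: scalar_prod_def)
    \<comment> \<open>Symmetry of \<open>A\<close> and \<open>A * Q = 0\<close> make the ranges of
      \<open>A\<close> and \<open>Q\<close> orthogonal, so the two summands of
      \<open>(A + Q) v = 0\<close> vanish separately.\<close>
    have "(A *\<^sub>v v) \<bullet> (Q *\<^sub>v v) = 0"
      using scalar_prod_mult_mat_vec[OF A v Qv] AQv0 v by (simp add: sym)
    moreover have "(A *\<^sub>v v) \<bullet> (A *\<^sub>v v + Q *\<^sub>v v) = (A *\<^sub>v v) \<bullet> (A *\<^sub>v v) + (A *\<^sub>v v) \<bullet> (Q *\<^sub>v v)"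
      by (rule scalar_prod_add_distrib[OF Av Av Qv])
    ultimately have "(A *\<^sub>v v) \<bullet> (A *\<^sub>v v) = 0" using sum0 Av by simp
    then have Av0: "A *\<^sub>v v = 0\<^sub>v n" by (rule real_scalar_prod_self_zero[OF Av])
    then have Qv0: "Q *\<^sub>v v = 0\<^sub>v n" using sum0 Qv by simp
    \<comment> \<open>The quadratic form of \<open>Q\<close> is the sum of the squares of x . v over
      x in \<open>K\<close>. Hence \<open>v\<close> is orthogonal to \<open>K\<close>, while it also
      lies in the span of \<open>K\<close>.\<close>
    have "v \<bullet> (Q *\<^sub>v v) = (\<Sum>r<n. \<Sum>c<n. \<Sum>x\<in>K. (v $ r * x $ r) * (x $ c * v $ c))"
      using v by (simp add: scalar_prod_def Q_def sum_distrib_left sum_distrib_right lessThan_atLeast0 mult_ac)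
    also have "\<dots> = (\<Sum>r<n. \<Sum>x\<in>K. \<Sum>c<n. (v $ r * x $ r) * (x $ c * v $ c))"
      by (intro sum.cong refl sum.swap)
    also have "\<dots> = (\<Sum>x\<in>K. \<Sum>r<n. \<Sum>c<n. (v $ r * x $ r) * (x $ c * v $ c))"
      by (rule sum.swap)
    also have "\<dots> = (\<Sum>x\<in>K. (x \<bullet> v) ^ 2)"
      using v by (simp add: scalar_prod_def power2_eq_square sum_product lessThan_atLeast0 mult_ac)
    finally have "(\<Sum>x\<in>K. (x \<bullet> v) ^ 2) = 0" using Qv0 v by simp
    then have xv: "x \<bullet> v = 0" if "x \<in> K" for x
      using finK that by (simp add: sum_nonneg_eq_0_iff)
    have "v \<in> mat_kernel A" using Av0 v A by (simp add: mat_kernelI)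
    then have "v \<in> span K" using spanK by simp
    then obtain a where va: "v = lincomb a K"
      using Ker.finite_span[OF finK] KA by auto
    have "v \<bullet> v = (\<Sum>k<n. (\<Sum>x\<in>K. a x * x $ k) * v $ k)"
      using v lincomb_index[OF _ KA, of _ a] va by (simp add: scalar_prod_def lessThan_atLeast0)
    also have "\<dots> = (\<Sum>x\<in>K. a x * (x \<bullet> v))"
      unfolding sum_distrib_right using v
      by (subst sum.swap) (simp add: scalar_prod_def sum_distrib_left lessThan_atLeast0 mult_ac)
    also have "\<dots> = 0" using xv by simp
    finally show ?thesis by (rule real_scalar_prod_self_zero[OF v])
  qed
  with that[OF Q QT AQ] show ?thesis by blast
qed

lemma square_mat_simps:
  fixes A B C :: "real mat"
  shows "A \<in> carrier_mat n n \<Longrightarrow> B \<in> carrier_mat n n \<Longrightarrow> A * B \<in> carrier_mat n n"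
    "A \<in> carrier_mat n n \<Longrightarrow> B \<in> carrier_mat n n \<Longrightarrow> C \<in> carrier_mat n n \<Longrightarrow> A * B * C = A * (B * C)"
  by simp_all

text \<open>The Penrose equations under the \<open>THE\<close> of \<open>pinv\<close>, isolated so
  that existence and uniqueness can be proved for them.\<close>

definition is_pinv :: "real mat \<Rightarrow> real mat \<Rightarrow> bool" where
  "is_pinv A X \<longleftrightarrow> X \<in> carrier_mat (dim_col A) (dim_row A) \<and> A * X * A = A \<and> X * A * X = X
              \<and> transpose_mat (A * X) = A * X \<and> transpose_mat (X * A) = X * A"

text \<open>Penrose's argument: symmetry of the products lets factors be swapped by transposing,
  which shows that \<open>X\<close> and \<open>Y\<close> induce the same projections
  \<open>A * X = A * Y\<close> and \<open>X * A = Y * A\<close>. Then X = XAX = XAY = YAY =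
  Y.\<close>

lemma is_pinv_unique:
  assumes "is_pinv A X" "is_pinv A Y"
  shows "X = Y"
proof -
  define m k where "m = dim_row A" and "k = dim_col A"
  have A: "A \<in> carrier_mat m k" by (auto simp: m_def k_def)
  have X: "X \<in> carrier_mat k m" and Y: "Y \<in> carrier_mat k m"
    using assms by (auto simp: is_pinv_def m_def k_def)
  have X1: "A * X * A = A" and X2: "X * A * X = X"
    and X3: "transpose_mat (A * X) = A * X" and X4: "transpose_mat (X * A) = X * A"
    and Y1: "A * Y * A = A" and Y2: "Y * A * Y = Y"
    and Y3: "transpose_mat (A * Y) = A * Y" and Y4: "transpose_mat (Y * A) = Y * A"
    using assms by (auto simp: is_pinv_def)
  note c = A X Y mult_carrier_mat[OF A X] mult_carrier_mat[OF A Y] mult_carrier_mat[OF X A] mult_carrier_mat[OF Y A]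
  have AXY: "A * X = A * Y"
  proof -
    have "A * X = transpose_mat (A * Y * (A * X))"
      using X3 assoc_mult_mat[OF c(5) A X] Y1 by simp
    also have "\<dots> = transpose_mat (A * X) * transpose_mat (A * Y)"
      by (rule transpose_mult[OF c(5) c(4)])
    also have "\<dots> = A * X * A * Y" using X3 Y3 assoc_mult_mat[OF c(4) A Y] by simp
    finally show ?thesis using X1 by simp
  qed
  have XAY: "X * A = Y * A"
  proof -
    have "X * A = transpose_mat (X * A * (Y * A))"
    proof -
      have "X * A * (Y * A) = X * (A * Y * A)"
        using assoc_mult_mat[OF X A c(7)] assoc_mult_mat[OF A Y A] by simp
      then show ?thesis using Y1 X4 by simp
    qed
    also have "\<dots> = transpose_mat (Y * A) * transpose_mat (X * A)"
      by (rule transpose_mult[OF c(6) c(7)])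
    also have "\<dots> = Y * (A * X * A)" using X4 Y4 assoc_mult_mat[OF Y A c(6)] assoc_mult_mat[OF A X A] by simp
    finally show ?thesis using X1 by simp
  qed
  have "X = X * (A * X)" using X2 assoc_mult_mat[OF X A X] by simp
  also have "\<dots> = X * A * Y" using AXY assoc_mult_mat[OF X A Y] by simp
  also have "\<dots> = Y" using XAY Y2 by simp
  finally show ?thesis .
qed

text \<open>Adding \<open>Q\<close> makes \<open>A\<close> invertible without disturbing it off its
  kernel. Since AQ = QA = 0, \<open>A\<close> commutes with \<open>A + Q\<close> and hence with the
  inverse \<open>M\<close>, so the Penrose equations become computations with commuting
  matrices.\<close>

lemma is_pinv_exists_symmetric:
  fixes A :: "real mat"
  assumes A: "A \<in> carrier_mat n n" and sym: "transpose_mat A = A"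
  shows "\<exists>X. is_pinv A X"
proof -
  obtain Q where Q: "Q \<in> carrier_mat n n" and QT: "transpose_mat Q = Q" and AQ: "A * Q = 0\<^sub>m n n"
    and inj: "\<And>v. v \<in> carrier_vec n \<Longrightarrow> (A + Q) *\<^sub>v v = 0\<^sub>v n \<Longrightarrow> v = 0\<^sub>v n"
    using symmetric_kernel_complement[OF A sym] by metis
  have AQc: "A + Q \<in> carrier_mat n n" using A Q by simp
  obtain M where M: "M \<in> carrier_mat n n" and M1: "(A + Q) * M = 1\<^sub>m n" and M2: "M * (A + Q) = 1\<^sub>m n"
    using injective_mat_inverse[OF AQc inj] by metis
  have QA: "Q * A = 0\<^sub>m n n"
    using arg_cong[OF AQ, of transpose_mat] transpose_mult[OF A Q] sym QT by simp
  have comm: "M * A = A * M"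
  proof -
    have cA: "A * (A + Q) = (A + Q) * A"
      using mult_add_distrib_mat[OF A A Q] add_mult_distrib_mat[OF A Q A] AQ QA by simp
    have "M * A = M * A * ((A + Q) * M)" using M1 M A by simp
    also have "\<dots> = M * (A * (A + Q)) * M"
      using M A AQc by (simp add: square_mat_simps[where n = n])
    also have "\<dots> = (M * (A + Q)) * A * M"
      unfolding cA using M A AQc by (simp add: square_mat_simps[where n = n])
    finally show ?thesis using M2 A by simp
  qed
  have MT: "transpose_mat M = M"
  proof -
    have "transpose_mat (A + Q) = A + Q" using transpose_add[OF A Q] sym QT by simp
    then have "transpose_mat M * (A + Q) = 1\<^sub>m n"
      using arg_cong[OF M1, of transpose_mat] transpose_mult[OF AQc M] by simp
    then have "transpose_mat M * (A + Q) * M = M" using M by simp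
    moreover have "transpose_mat M * (A + Q) * M = transpose_mat M"
      using M1 M AQc by (simp add: square_mat_simps[where n = n])
    ultimately show ?thesis by simp
  qed
  have AAM: "A * A * M = A"
  proof -
    have "A = A * ((A + Q) * M)" using M1 A by simp
    also have "\<dots> = (A * A + A * Q) * M"
      using M A AQc mult_add_distrib_mat[OF A A Q] by (simp add: square_mat_simps[where n = n] flip: mult_add_distrib_mat[OF A A Q])
    finally show ?thesis using AQ A M by simp
  qed
  have AMA: "A * M * A = A"
    using AAM comm A M by (simp add: square_mat_simps[where n = n])
  \<comment> \<open>\<open>M\<close> already satisfies AMA = A, but in general it does not vanish on
    the kernel of \<open>A\<close>; sandwiching \<open>A\<close> gives XAX = X as well.\<close>
  define X where "X = M * A * M"
  have X: "X \<in> carrier_mat n n" using M A by (simp add: X_def)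
  have AX: "A * X = A * M"
    unfolding X_def using arg_cong[OF AMA, of "\<lambda>Z. Z * M"] A M by (simp add: square_mat_simps[where n = n])
  have XA: "X * A = A * M"
  proof -
    have "X * A = M * (A * M * A)" using A M by (simp add: X_def square_mat_simps[where n = n])
    then show ?thesis unfolding AMA comm .
  qed
  have "transpose_mat (A * M) = A * M"
    using transpose_mult[OF A M] sym MT comm by simp
  moreover have "X * A * X = X"
  proof -
    have "X * A * X = (M * A) * (M * A * M)"
      unfolding XA unfolding X_def comm ..
    also have "\<dots> = M * (A * M * A) * M"
      using A M by (simp add: square_mat_simps[where n = n])
    finally show ?thesis using AMA X_def by simp
  qed
  ultimately have "is_pinv A X"
    using A X AX XA AMA by (simp add: is_pinv_def)
  then show ?thesis ..
qed

lemma pinv_symmetric: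
  fixes A :: "real mat"
  assumes "A \<in> carrier_mat n n" "transpose_mat A = A"
  shows "is_pinv A (pinv A)"
proof -
  have "\<exists>!X. is_pinv A X"
    using is_pinv_exists_symmetric[OF assms] is_pinv_unique by blast
  from theI'[OF this] show ?thesis unfolding pinv_def is_pinv_def by simp
qed

lemma pinv_symmetric_injective:
  fixes A :: "real mat"
  assumes A: "A \<in> carrier_mat n n" and sym: "transpose_mat A = A"
    and inj: "\<And>v. v \<in> carrier_vec n \<Longrightarrow> A *\<^sub>v v = 0\<^sub>v n \<Longrightarrow> v = 0\<^sub>v n"
  shows "pinv A \<in> carrier_mat n n" "A * pinv A = 1\<^sub>m n"
proof -
  note X = pinv_symmetric[OF A sym, unfolded is_pinv_def]
  show Xc: "pinv A \<in> carrier_mat n n" using X A by auto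
  obtain B where B: "B \<in> carrier_mat n n" "A * B = 1\<^sub>m n"
    using injective_mat_inverse[OF A inj] by metis
  have "A * pinv A = A * pinv A * (A * B)" using B A Xc by simp
  also have "\<dots> = A * pinv A * A * B" using A B Xc by (simp add: square_mat_simps[where n = n])
  finally show "A * pinv A = 1\<^sub>m n" using X B by simp
qed

lemma minv_injective:
  fixes A :: "real mat"
  assumes A: "A \<in> carrier_mat n n"
    and inj: "\<And>v. v \<in> carrier_vec n \<Longrightarrow> A *\<^sub>v v = 0\<^sub>v n \<Longrightarrow> v = 0\<^sub>v n"
  shows "minv A \<in> carrier_mat n n" "A * minv A = 1\<^sub>m n"
proof -
  obtain B where B: "B \<in> carrier_mat n n" "A * B = 1\<^sub>m n" "B * A = 1\<^sub>m n"
    using injective_mat_inverse[OF A inj] by metis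
  have "minv A = B" unfolding minv_def
  proof (rule the_equality)
    fix C assume "C \<in> carrier_mat (dim_row A) (dim_row A) \<and> A * C = 1\<^sub>m (dim_row A) \<and> C * A = 1\<^sub>m (dim_row A)"
    then have C: "C \<in> carrier_mat n n" "A * C = 1\<^sub>m n" using A by auto
    have "C = B * A * C" using B(3) C(1) by simp
    also have "\<dots> = B" using A B(1) C by (simp add: square_mat_simps[where n = n])
    finally show "C = B" .
  qed (use A B in auto)
  then show "minv A \<in> carrier_mat n n" "A * minv A = 1\<^sub>m n" using B by auto
qed

text \<open>The residual t = b - A A^+ b lies in the kernel of \<open>A\<close>. It is therefore
  orthogonal to \<open>b\<close> by hypothesis and to the range of \<open>A\<close> by symmetry,
  hence to itself.\<close>

lemma pinv_solves:
  fixes A :: "real mat"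
  assumes A: "A \<in> carrier_mat n n" and sym: "transpose_mat A = A" and b: "b \<in> carrier_vec n"
    and orth: "\<And>v. v \<in> carrier_vec n \<Longrightarrow> A *\<^sub>v v = 0\<^sub>v n \<Longrightarrow> v \<bullet> b = 0"
  shows "A *\<^sub>v (pinv A *\<^sub>v b) = b"
proof -
  define X where "X = pinv A"
  note p = pinv_symmetric[OF A sym, folded X_def, unfolded is_pinv_def]
  have X: "X \<in> carrier_mat n n" using p A by auto
  have AX: "A * X \<in> carrier_mat n n" using A X by simp
  define s where "s = A *\<^sub>v (X *\<^sub>v b)"
  have sc: "s \<in> carrier_vec n" using A X b by (simp add: s_def)
  \<comment> \<open>The transpose of the Penrose equation AXA = A.\<close>
  have AAX: "A * (A * X) = A"
    using arg_cong[OF conjunct1[OF conjunct2[OF p]], of transpose_mat] transpose_mult[OF AX A] p sym by simp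
  have "A *\<^sub>v s = A *\<^sub>v b"
    using AAX assoc_mult_mat_vec[OF A AX b] assoc_mult_mat_vec[OF A X b] by (simp add: s_def)
  then have A0: "A *\<^sub>v (b - s) = 0\<^sub>v n"
    using mult_minus_distrib_mat_vec[OF A b sc] A b by simp
  define t where "t = b - s"
  have tc: "t \<in> carrier_vec n" using b sc by (simp add: t_def)
  have "t \<bullet> s = 0"
    using scalar_prod_mult_mat_vec[OF A tc, of "X *\<^sub>v b"] A0 X b sym by (simp add: s_def t_def)
  moreover have "t \<bullet> b = 0" using orth[OF tc] A0 by (simp add: t_def)
  moreover have "t \<bullet> t = t \<bullet> b - t \<bullet> s"
    unfolding t_def[of, symmetric] using scalar_prod_minus_distrib[OF tc b sc] t_def by simp
  ultimately have "t = 0\<^sub>v n" using real_scalar_prod_self_zero[OF tc] by simp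
  then have "b - s = 0\<^sub>v n" by (simp add: t_def)
  then have "b = s" using b sc
    by (metis carrier_vecD eq_iff_diff_eq_0 eq_vecI index_minus_vec(1) index_zero_vec(1))
  then show ?thesis by (simp add: s_def X_def)
qed

section \<open>The connection Laplacian and its Dirichlet form\<close>

lemma orth_rows:
  assumes "orth d A" "a < d" "b < d"
  shows "(\<Sum>c<d. A $$ (a,c) * A $$ (b,c)) = (if a = b then 1 else 0)"
proof -
  have A: "A \<in> carrier_mat d d" and AA: "A * transpose_mat A = 1\<^sub>m d"
    using assms(1) by (auto simp: orth_def)
  have "(A * transpose_mat A) $$ (a,b) = (\<Sum>c<d. A $$ (a,c) * A $$ (b,c))"
    using A assms by (simp add: scalar_prod_def lessThan_atLeast0)
  then show ?thesis using AA assms by simp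
qed

text \<open>\<open>orth\<close> asks for a one-sided inverse only; for square matrices it is
  two-sided.\<close>

lemma orth_transpose:
  assumes "orth d A"
  shows "orth d (transpose_mat A)"
  using assms mat_mult_left_right_inverse[of A d "transpose_mat A"] by (auto simp: orth_def)

lemma orth_columns:
  assumes "orth d A" "a < d" "b < d"
  shows "(\<Sum>c<d. A $$ (c,a) * A $$ (c,b)) = (if a = b then 1 else 0)"
proof -
  have "A \<in> carrier_mat d d" using assms(1) by (simp add: orth_def)
  then show ?thesis using orth_rows[OF orth_transpose[OF assms(1)] assms(2,3)] assms by simp
qed

lemma orth_mult:
  assumes "orth d A" "orth d B"
  shows "orth d (A * B)"
proof -
  have A: "A \<in> carrier_mat d d" and B: "B \<in> carrier_mat d d"
    and AA: "A * transpose_mat A = 1\<^sub>m d" and BB: "B * transpose_mat B = 1\<^sub>m d"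
    using assms by (auto simp: orth_def)
  have "A * B * transpose_mat (A * B) = A * (B * transpose_mat B) * transpose_mat A"
    using A B transpose_mult[OF A B] by (simp add: square_mat_simps[where n = d])
  then show ?thesis using A B AA BB by (simp add: orth_def)
qed

text \<open>This bound lets the hitting probabilities dominate the entries of the series for
  \<open>Omega\<close>.\<close>

lemma orth_entry_le_1:
  assumes "orth d A" "a < d" "b < d"
  shows "\<bar>A $$ (a,b)\<bar> \<le> 1"
proof -
  have "(A $$ (a,b))\<^sup>2 \<le> (\<Sum>c<d. (A $$ (a,c))\<^sup>2)"
    using assms by (intro member_le_sum) auto
  also have "\<dots> = 1" using orth_rows[OF assms(1,2,2)] by (simp add: power2_eq_square)
  finally show ?thesis by (simp add: abs_square_le_1)
qed

lemma orth_isometry: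
  assumes "orth d A"
  shows "(\<Sum>a<d. (\<Sum>b<d. A $$ (a,b) * z b)\<^sup>2) = (\<Sum>b<d. (z b)\<^sup>2)"
proof -
  have "(\<Sum>a<d. (\<Sum>b<d. A $$ (a,b) * z b)\<^sup>2) =
      (\<Sum>a<d. \<Sum>b<d. \<Sum>c<d. z b * z c * (A $$ (a,b) * A $$ (a,c)))"
    by (simp add: power2_eq_square sum_product mult_ac)
  also have "\<dots> = (\<Sum>b<d. \<Sum>a<d. \<Sum>c<d. z b * z c * (A $$ (a,b) * A $$ (a,c)))"
    by (rule sum.swap)
  also have "\<dots> = (\<Sum>b<d. \<Sum>c<d. \<Sum>a<d. z b * z c * (A $$ (a,b) * A $$ (a,c)))"
    by (intro sum.cong refl sum.swap)
  also have "\<dots> = (\<Sum>b<d. \<Sum>c<d. z b * z c * (if b = c then 1 else 0))"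
    by (intro sum.cong refl) (simp add: orth_columns[OF assms] flip: sum_distrib_left)
  also have "\<dots> = (\<Sum>b<d. (z b)\<^sup>2)"
    by (simp add: power2_eq_square if_distrib cong: if_cong)
  finally show ?thesis .
qed

section \<open>Block indices and functions on nodes\<close>

lemma block_index:
  fixes a d x :: nat
  assumes "a < d"
  shows "(x * d + a) div d = x" "(x * d + a) mod d = a" "x < n \<Longrightarrow> x * d + a < n * d"
proof -
  assume "x < n"
  then have "Suc x * d \<le> n * d" by (intro mult_le_mono1) simp
  then show "x * d + a < n * d" using assms by simp
qed (use assms in auto)

lemma block_index_cases:
  fixes r n d :: nat
  assumes "r < n * d"
  obtains x a where "x < n" "a < d" "r = x * d + a"
proof
  show "r div d < n" using assms by (simp add: less_mult_imp_div_less)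
  show "r mod d < d" using assms by (cases "d = 0") auto
  show "r = r div d * d + r mod d" by simp
qed

lemma sum_blocks:
  fixes g :: "nat \<Rightarrow> 'a :: comm_monoid_add"
  shows "(\<Sum>r<n*d. g r) = (\<Sum>x<n. \<Sum>a<d. g (x * d + a))"
proof -
  have "(\<Sum>r<n*d. g r) = (\<Sum>x<n. sum g {x*d..<x*d+d})"
    by (rule sum.nat_group[symmetric])
  also have "\<dots> = (\<Sum>x<n. \<Sum>a<d. g (x * d + a))"
  proof (rule sum.cong[OF refl])
    show "sum g {x*d..<x*d+d} = (\<Sum>a<d. g (x * d + a))" for x
      using sum.shift_bounds_nat_ivl[of g 0 "x*d" d] by (simp add: lessThan_atLeast0 add.commute)
  qed
  finally show ?thesis .
qed

lemma block_vec_eqI: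
  assumes "u \<in> carrier_vec (n*d)" "v \<in> carrier_vec (n*d)"
    and "\<And>x a. x < n \<Longrightarrow> a < d \<Longrightarrow> u $ (x*d+a) = v $ (x*d+a)"
  shows "u = v"
proof (rule eq_vecI)
  fix r assume "r < dim_vec v"
  then show "u $ r = v $ r" using assms by (auto elim!: block_index_cases)
qed (use assms in auto)

text \<open>The work is done with functions \<open>z x a\<close> of node and component;
  \<open>flat\<close> carries them to the vectors on which the matrices act.\<close>

definition flat :: "nat \<Rightarrow> nat \<Rightarrow> (nat \<Rightarrow> nat \<Rightarrow> real) \<Rightarrow> real vec" where
  "flat n d z = vec (n*d) (\<lambda>r. z (r div d) (r mod d))"

lemma flat_carrier [simp]: "flat n d z \<in> carrier_vec (n*d)"
  by (simp add: flat_def)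

lemma dim_flat [simp]: "dim_vec (flat n d z) = n*d"
  by (simp add: flat_def)

lemma flat_index: "x < n \<Longrightarrow> a < d \<Longrightarrow> flat n d z $ (x*d+a) = z x a"
  by (simp add: flat_def block_index)

lemma flat_unflat: "v \<in> carrier_vec (n*d) \<Longrightarrow> flat n d (\<lambda>x a. v $ (x*d+a)) = v"
  by (rule block_vec_eqI[of _ n d]) (simp_all add: flat_index)

lemma flat_scalar_prod: "flat n d u \<bullet> flat n d v = (\<Sum>x<n. \<Sum>a<d. u x a * v x a)"
  by (simp add: scalar_prod_def flat_def sum_blocks block_index flip: lessThan_atLeast0)

text \<open>The connection Laplacian as an operator on functions. The sum runs over all nodes rather
  than neighbours, because the weight is 0 at non-edges and on the diagonal, where the signature is
  arbitrary.\<close>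

definition conn_op ::
  "nat \<Rightarrow> nat \<Rightarrow> (nat \<Rightarrow> nat \<Rightarrow> real) \<Rightarrow> (nat \<Rightarrow> nat \<Rightarrow> real mat) \<Rightarrow> (nat \<Rightarrow> nat \<Rightarrow> real) \<Rightarrow> nat \<Rightarrow> nat \<Rightarrow> real" where
  "conn_op n d w \<sigma> z x a = deg n w x * z x a - (\<Sum>y<n. \<Sum>b<d. w x y * \<sigma> x y $$ (a,b) * z y b)"

lemma conn_lap_carrier [simp]: "conn_lap n d w \<sigma> \<in> carrier_mat (n*d) (n*d)"
  by (simp add: conn_lap_def)

lemma conn_lap_index:
  assumes "wgraph n w" "x < n" "a < d" "y < n" "b < d"
  shows "conn_lap n d w \<sigma> $$ (x*d+a, y*d+b) =
    (if x = y \<and> a = b then deg n w x else 0) - w x y * \<sigma> x y $$ (a,b)"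
proof -
  have "w x x = 0" "w x y \<ge> 0" using assms(1) by (auto simp: wgraph_def)
  then show ?thesis using assms(2-) by (auto simp: conn_lap_def block_index)
qed

lemma conn_lap_mult:
  assumes "wgraph n w" "x < n" "a < d"
  shows "(conn_lap n d w \<sigma> *\<^sub>v flat n d z) $ (x*d+a) = conn_op n d w \<sigma> z x a"
proof -
  have "(conn_lap n d w \<sigma> *\<^sub>v flat n d z) $ (x*d+a) =
      (\<Sum>r<n*d. conn_lap n d w \<sigma> $$ (x*d+a, r) * flat n d z $ r)"
    using assms conn_lap_carrier[of n d w \<sigma>] block_index(3)[OF assms(3,2)]
    by (auto simp: scalar_prod_def lessThan_atLeast0 simp del: conn_lap_carrier)
  also have "\<dots> = (\<Sum>y<n. \<Sum>b<d. ((if x = y \<and> a = b then deg n w x else 0) - w x y * \<sigma> x y $$ (a,b)) * z y b)"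
    unfolding sum_blocks using assms by (intro sum.cong refl) (simp add: conn_lap_index flat_index)
  also have "\<dots> = (\<Sum>y<n. \<Sum>b<d. if x = y then if a = b then deg n w x * z y b else 0 else 0)
      - (\<Sum>y<n. \<Sum>b<d. w x y * \<sigma> x y $$ (a,b) * z y b)"
    unfolding sum_subtractf[symmetric] by (intro sum.cong refl) (simp add: algebra_simps)
  also have "(\<Sum>y<n. \<Sum>b<d. if x = y then if a = b then deg n w x * z y b else 0 else 0) =
      (\<Sum>y<n. if x = y then deg n w x * z y a else 0)"
    using assms by (intro sum.cong refl) simp
  finally show ?thesis using assms by (simp add: conn_op_def)
qed

lemma conn_lap_flat:
  assumes "wgraph n w"
  shows "conn_lap n d w \<sigma> *\<^sub>v flat n d z = flat n d (conn_op n d w \<sigma> z)"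
  by (rule block_vec_eqI[of _ n d])
    (auto simp: conn_lap_mult[OF assms] flat_index intro: mult_mat_vec_carrier[OF conn_lap_carrier])

lemma conn_lap_symmetric:
  assumes w: "wgraph n w" and s: "signature n d w \<sigma>"
  shows "transpose_mat (conn_lap n d w \<sigma>) = conn_lap n d w \<sigma>"
proof (rule eq_matI)
  fix r c assume "r < dim_row (conn_lap n d w \<sigma>)" "c < dim_col (conn_lap n d w \<sigma>)"
  then have "r < n*d" "c < n*d" by (auto simp: conn_lap_def)
  then obtain x a y b where xa: "x < n" "a < d" "r = x*d+a" "y < n" "b < d" "c = y*d+b"
    by (elim block_index_cases)
  have wxy: "w x y = w y x" "w x y \<ge> 0" using w by (auto simp: wgraph_def)
  have "w x y * \<sigma> x y $$ (a,b) = w y x * \<sigma> y x $$ (b,a)"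
  proof (cases "w x y = 0")
    case False
    then have "0 < w x y" using wxy by simp
    then have "orth d (\<sigma> x y)" "\<sigma> y x = transpose_mat (\<sigma> x y)"
      using s xa by (auto simp: signature_def)
    then show ?thesis using xa wxy by (auto simp: orth_def)
  qed (use wxy in simp)
  then show "transpose_mat (conn_lap n d w \<sigma>) $$ (r, c) = conn_lap n d w \<sigma> $$ (r, c)"
    using xa block_index(3)[OF xa(2,1)] block_index(3)[OF xa(5,4)]
      carrier_matD[OF conn_lap_carrier[of n d w \<sigma>]]
    by (auto simp: conn_lap_index[OF w])
qed (simp_all add: conn_lap_def)

lemma conn_op_selfadjoint:
  assumes "wgraph n w" "signature n d w \<sigma>"
  shows "(\<Sum>x<n. \<Sum>a<d. u x a * conn_op n d w \<sigma> z x a) = (\<Sum>x<n. \<Sum>a<d. conn_op n d w \<sigma> u x a * z x a)"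
  using scalar_prod_mult_mat_vec[OF conn_lap_carrier flat_carrier flat_carrier, of n d u w \<sigma> z] assms
  by (simp add: conn_lap_symmetric conn_lap_flat flat_scalar_prod)

section \<open>The energy as a sum of squares over edges\<close>

lemma conn_op_edges:
  "conn_op n d w \<sigma> z x a = (\<Sum>y<n. w x y * (z x a - (\<Sum>b<d. \<sigma> x y $$ (a,b) * z y b)))"
  by (simp add: conn_op_def deg_def algebra_simps sum_subtractf sum_distrib_left sum_distrib_right)

text \<open>After expanding the square, orthogonality replaces the norm of \<sigma>_xy z(y) by that
  of z(y), and symmetry of the weights cancels the two sums of norms against each other. The factor
  2 reflects that each edge is counted in both orientations.\<close>

lemma dirichlet_form:
  assumes w: "wgraph n w" and s: "signature n d w \<sigma>"
  shows "2 * (\<Sum>x<n. \<Sum>a<d. z x a * conn_op n d w \<sigma> z x a) =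
    (\<Sum>x<n. \<Sum>y<n. w x y * (\<Sum>a<d. (z x a - (\<Sum>b<d. \<sigma> x y $$ (a,b) * z y b))\<^sup>2))"
proof -
  define q where "q x y a = (\<Sum>b<d. \<sigma> x y $$ (a,b) * z y b)" for x y a
  define N where "N x = (\<Sum>a<d. (z x a)\<^sup>2)" for x
  have iso: "w x y * (\<Sum>a<d. (q x y a)\<^sup>2) = w x y * N y" if "x < n" "y < n" for x y
  proof (cases "w x y = 0")
    case False
    then have "0 < w x y" using w by (metis wgraph_def order_le_less)
    then have "orth d (\<sigma> x y)" using s that by (simp add: signature_def)
    then show ?thesis by (simp add: q_def N_def orth_isometry)
  qed simp
  have "(\<Sum>x<n. \<Sum>y<n. w x y * (\<Sum>a<d. (z x a - q x y a)\<^sup>2)) =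
      (\<Sum>x<n. \<Sum>y<n. 2 * (\<Sum>a<d. z x a * (w x y * (z x a - q x y a))) + w x y * N y - w x y * N x)"
  proof (intro sum.cong refl)
    fix x y assume xy: "x \<in> {..<n}" "y \<in> {..<n}"
    have "w x y * (\<Sum>a<d. (z x a - q x y a)\<^sup>2) =
        2 * (\<Sum>a<d. z x a * (w x y * (z x a - q x y a))) + w x y * (\<Sum>a<d. (q x y a)\<^sup>2) - w x y * N x"
      unfolding N_def sum_distrib_left sum.distrib[symmetric] sum_subtractf[symmetric]
      by (intro sum.cong refl) (simp add: power2_eq_square algebra_simps)
    then show "w x y * (\<Sum>a<d. (z x a - q x y a)\<^sup>2) =
        2 * (\<Sum>a<d. z x a * (w x y * (z x a - q x y a))) + w x y * N y - w x y * N x"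
      using iso xy by simp
  qed
  also have "\<dots> = 2 * (\<Sum>x<n. \<Sum>y<n. \<Sum>a<d. z x a * (w x y * (z x a - q x y a)))
      + (\<Sum>x<n. \<Sum>y<n. w x y * N y) - (\<Sum>x<n. \<Sum>y<n. w x y * N x)"
    by (simp add: sum.distrib sum_subtractf sum_distrib_left)
  also have "(\<Sum>x<n. \<Sum>y<n. w x y * N y) = (\<Sum>x<n. \<Sum>y<n. w x y * N x)"
    using w by (subst sum.swap) (simp add: wgraph_def)
  also have "(\<Sum>x<n. \<Sum>y<n. \<Sum>a<d. z x a * (w x y * (z x a - q x y a))) =
      (\<Sum>x<n. \<Sum>a<d. z x a * conn_op n d w \<sigma> z x a)"
    unfolding conn_op_edges sum_distrib_left q_def[symmetric] by (intro sum.cong refl sum.swap)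
  finally show ?thesis by (simp add: q_def)
qed

text \<open>Every summand of \<open>dirichlet_form\<close> is nonnegative, so each one with positive
  weight must vanish.\<close>

lemma zero_energy_parallel:
  assumes w: "wgraph n w" and s: "signature n d w \<sigma>"
    and zero: "(\<Sum>x<n. \<Sum>a<d. z x a * conn_op n d w \<sigma> z x a) = 0"
    and "x < n" "y < n" "0 < w x y" "a < d"
  shows "z x a = (\<Sum>b<d. \<sigma> x y $$ (a,b) * z y b)"
proof -
  have w0: "w x y \<ge> 0" for x y using w by (simp add: wgraph_def)
  define E where "E x y a = (z x a - (\<Sum>b<d. \<sigma> x y $$ (a,b) * z y b))\<^sup>2" for x y a
  have E0: "E x y a \<ge> 0" for x y a by (simp add: E_def)
  have nn: "w x y * (\<Sum>a<d. E x y a) \<ge> 0" for x y using w0 E0 by (intro mult_nonneg_nonneg sum_nonneg)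
  have "(\<Sum>x<n. \<Sum>y<n. w x y * (\<Sum>a<d. E x y a)) = 0"
    using dirichlet_form[OF w s, of z] zero by (simp add: E_def)
  then have "(\<Sum>y<n. w x y * (\<Sum>a<d. E x y a)) = 0"
    using assms(4) nn by (subst (asm) sum_nonneg_eq_0_iff) (auto intro!: sum_nonneg)
  then have "w x y * (\<Sum>a<d. E x y a) = 0"
    using assms(5) nn by (subst (asm) sum_nonneg_eq_0_iff) auto
  then have "(\<Sum>a<d. E x y a) = 0" using assms(6) by simp
  then have "E x y a = 0" using assms(7) E0 by (subst (asm) sum_nonneg_eq_0_iff) auto
  then show ?thesis by (simp add: E_def)
qed

text \<open>For this positive semidefinite operator zero energy already means membership in the
  kernel, since \<open>conn_op_edges\<close> expresses the current through the same edge
  differences.\<close>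

lemma zero_energy_kernel:
  assumes w: "wgraph n w" and s: "signature n d w \<sigma>"
    and zero: "(\<Sum>x<n. \<Sum>a<d. z x a * conn_op n d w \<sigma> z x a) = 0"
    and "x < n" "a < d"
  shows "conn_op n d w \<sigma> z x a = 0"
  unfolding conn_op_edges
proof (rule sum.neutral, intro ballI)
  fix y assume "y \<in> {..<n}"
  moreover have "w x y \<ge> 0" using w by (simp add: wgraph_def)
  ultimately show "w x y * (z x a - (\<Sum>b<d. \<sigma> x y $$ (a,b) * z y b)) = 0"
    using zero_energy_parallel[OF w s zero \<open>x < n\<close> _ _ \<open>a < d\<close>] by (cases "w x y = 0") auto
qed

section \<open>Harmonicity of the hitting holonomy\<close>

lemma finite_hit_paths: "finite (hit_paths n x j t)"
proof (rule finite_subset)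
  show "hit_paths n x j t \<subseteq> {ps. set ps \<subseteq> {..<n} \<and> length ps = Suc t}"
    by (auto simp: hit_paths_def)
qed (rule finite_lists_length_eq, simp)

lemma hit_paths_start:
  assumes "ps \<in> hit_paths n x j t"
  obtains qs where "ps = x # qs" "x < n" "set qs \<subseteq> {..<n}"
  using assms by (cases ps) (auto simp: hit_paths_def)

lemma hit_paths_refl_0: "j < n \<Longrightarrow> hit_paths n j j 0 = {[j]}"
  by (auto simp: hit_paths_def length_Suc_conv)

lemma hit_paths_refl_Suc: "hit_paths n j j (Suc t) = {}"
  by (auto simp: hit_paths_def length_Suc_conv)

lemma hit_paths_0: "x \<noteq> j \<Longrightarrow> hit_paths n x j 0 = {}"
  by (auto simp: hit_paths_def length_Suc_conv)

text \<open>First-step decomposition. As \<open>x\<close> differs from \<open>j\<close>, prepending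
  it creates no earlier visit to \<open>j\<close>.\<close>

lemma hit_paths_Suc:
  assumes "x < n" "x \<noteq> j"
  shows "hit_paths n x j (Suc t) = (\<lambda>(y,qs). x # qs) ` (SIGMA y:{..<n}. hit_paths n y j t)"
proof (intro equalityI subsetI)
  fix ps assume ps: "ps \<in> hit_paths n x j (Suc t)"
  then obtain y r where "ps = x # y # r"
    by (auto simp: hit_paths_def length_Suc_conv)
  then have "y < n" "ps = (\<lambda>(y,qs). x # qs) (y, y # r)" "y # r \<in> hit_paths n y j t"
    using ps by (auto simp: hit_paths_def)
  then show "ps \<in> (\<lambda>(y,qs). x # qs) ` (SIGMA y:{..<n}. hit_paths n y j t)"
    by (metis (no_types, lifting) SigmaI image_eqI lessThan_iff)
next
  fix ps assume "ps \<in> (\<lambda>(y,qs). x # qs) ` (SIGMA y:{..<n}. hit_paths n y j t)"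
  then obtain y qs where "ps = x # qs" "qs \<in> hit_paths n y j t" by auto
  then show "ps \<in> hit_paths n x j (Suc t)"
    using assms by (auto simp: hit_paths_def)
qed

lemma sum_hit_paths_Suc:
  assumes "x < n" "x \<noteq> j"
  shows "(\<Sum>ps\<in>hit_paths n x j (Suc t). h ps) = (\<Sum>y<n. \<Sum>qs\<in>hit_paths n y j t. h (x # qs))"
proof -
  have inj: "inj_on (\<lambda>(y,qs). x # qs) (SIGMA y:{..<n}. hit_paths n y j t)"
    by (auto simp: inj_on_def hit_paths_def)
  show ?thesis
    unfolding hit_paths_Suc[OF assms] sum.reindex[OF inj]
    by (subst sum.Sigma) (auto simp: finite_hit_paths intro!: sum.cong)
qed

lemma walk_prob_nonneg:
  assumes "wgraph n w"
  shows "walk_prob n w ps \<ge> 0"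
  using assms by (induction n w ps rule: walk_prob.induct)
    (auto simp: wgraph_def deg_def intro!: mult_nonneg_nonneg divide_nonneg_nonneg sum_nonneg)

text \<open>Nonzero probability forces every step of the path to be an edge; elsewhere the signature
  is unconstrained.\<close>

lemma path_prod_orth:
  assumes "wgraph n w" "signature n d w \<sigma>" "set ps \<subseteq> {..<n}" "walk_prob n w ps \<noteq> 0"
  shows "orth d (path_prod d \<sigma> ps)"
  using assms
proof (induction d \<sigma> ps rule: path_prod.induct)
  case (1 d \<sigma> x y ps)
  then have "w x y \<noteq> 0" "w x y \<ge> 0" by (auto simp: wgraph_def)
  then have "0 < w x y" by simp
  then have "orth d (\<sigma> x y)" using 1 by (auto simp: signature_def)
  then show ?case using 1 by (auto intro: orth_mult)
qed (auto simp: orth_def)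

text \<open>Induction on the horizon \<open>m\<close>: conditioning on the first step averages the
  bounds at the next nodes with transition weights of total at most 1.\<close>

lemma hitting_prob_le_1:
  assumes w: "wgraph n w" and "x < n" "j < n"
  shows "(\<Sum>t<m. \<Sum>ps\<in>hit_paths n x j t. walk_prob n w ps) \<le> 1"
  using \<open>x < n\<close>
proof (induction m arbitrary: x)
  case (Suc m)
  show ?case
  proof (cases "x = j")
    case True
    then show ?thesis using \<open>j < n\<close>
      by (simp add: sum.lessThan_Suc_shift hit_paths_refl_0 hit_paths_refl_Suc del: sum.lessThan_Suc)
  next
    case False
    define P where "P y t = (\<Sum>ps\<in>hit_paths n y j t. walk_prob n w ps)" for y t
    have d0: "deg n w x \<ge> 0" and w0: "\<And>y. w x y \<ge> 0"
      using w by (auto simp: wgraph_def deg_def intro!: sum_nonneg)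
    have P: "P x (Suc t) = (\<Sum>y<n. w x y / deg n w x * P y t)" for t
      unfolding P_def sum_hit_paths_Suc[OF Suc.prems False] sum_distrib_left
      by (intro sum.cong refl) (auto elim: hit_paths_start)
    have "(\<Sum>t<Suc m. P x t) = (\<Sum>t<m. P x (Suc t))"
      using False by (simp add: sum.lessThan_Suc_shift P_def hit_paths_0 del: sum.lessThan_Suc)
    also have "\<dots> = (\<Sum>y<n. w x y / deg n w x * (\<Sum>t<m. P y t))"
      unfolding P sum_distrib_left by (rule sum.swap)
    also have "\<dots> \<le> (\<Sum>y<n. w x y / deg n w x * 1)"
      using Suc.IH d0 w0 by (intro sum_mono mult_left_mono) (auto simp: P_def)
    \<comment> \<open>The quotient is 1, or 0 at a node of degree 0, because division by zero yields
      0.\<close>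
    also have "\<dots> = deg n w x / deg n w x"
      by (simp add: deg_def flip: sum_divide_distrib)
    also have "\<dots> \<le> 1" by simp
    finally show ?thesis by (simp add: P_def)
  qed
qed simp

definition Omega_term where
  "Omega_term n d w \<sigma> x j a b t = (\<Sum>ps\<in>hit_paths n x j t. walk_prob n w ps * (path_prod d \<sigma> ps $$ (a,b)))"

lemma Omega_index:
  "a < d \<Longrightarrow> b < d \<Longrightarrow> Omega n d w \<sigma> x j $$ (a,b) = (\<Sum>t. Omega_term n d w \<sigma> x j a b t)"
  by (simp add: Omega_def Omega_term_def)

text \<open>The t-th term is a combination of orthogonal matrices weighted by path probabilities, so
  its entries are at most the probability of hitting \<open>j\<close> at time t. Without summability
  the infinite sum in \<open>Omega\<close> would carry no information.\<close>

lemma summable_Omega: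
  assumes w: "wgraph n w" and s: "signature n d w \<sigma>" and "x < n" "j < n" "a < d" "b < d"
  shows "summable (Omega_term n d w \<sigma> x j a b)"
proof (rule summable_comparison_test)
  define P where "P t = (\<Sum>ps\<in>hit_paths n x j t. walk_prob n w ps)" for t
  have P0: "P t \<ge> 0" for t using walk_prob_nonneg[OF w] by (simp add: P_def sum_nonneg)
  show "summable P"
    using hitting_prob_le_1[OF w \<open>x < n\<close> \<open>j < n\<close>]
    by (intro bounded_imp_summable[of P 1] P0)
      (simp only: P_def flip: lessThan_Suc_atMost)
  have "norm (Omega_term n d w \<sigma> x j a b t) \<le> P t" for t
    unfolding Omega_term_def P_def
  proof (rule sum_norm_le)
    fix ps assume "ps \<in> hit_paths n x j t"
    then have "set ps \<subseteq> {..<n}" by (simp add: hit_paths_def)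
    then have "walk_prob n w ps = 0 \<or> \<bar>path_prod d \<sigma> ps $$ (a,b)\<bar> \<le> 1"
      using path_prod_orth[OF w s] orth_entry_le_1 assms by blast
    then show "norm (walk_prob n w ps * path_prod d \<sigma> ps $$ (a,b)) \<le> walk_prob n w ps"
      using walk_prob_nonneg[OF w, of ps] by (auto simp: abs_mult mult_left_le)
  qed
  then show "\<exists>N. \<forall>t\<ge>N. norm (Omega_term n d w \<sigma> x j a b t) \<le> P t" by blast
qed

lemma Omega_diag:
  assumes "j < n" "a < d" "b < d"
  shows "Omega n d w \<sigma> j j $$ (a,b) = (if a = b then 1 else 0)"
proof -
  have "Omega_term n d w \<sigma> j j a b t = (if t = 0 then if a = b then 1 else 0 else 0)" for t
    using assms by (cases t) (auto simp: Omega_term_def hit_paths_refl_0 hit_paths_refl_Suc)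
  then have "(\<lambda>t. Omega_term n d w \<sigma> j j a b t) = (\<lambda>t. if t = 0 then (if a = b then 1 else 0) else 0)"
    by auto
  then show ?thesis using assms sums_unique[OF sums_single[of 0 "\<lambda>_. if a = b then 1 else (0::real)"]]
    by (simp add: Omega_index)
qed

lemma Omega_term_Suc:
  assumes w: "wgraph n w" and s: "signature n d w \<sigma>" and "x < n" "x \<noteq> j" "a < d" "b < d"
  shows "Omega_term n d w \<sigma> x j a b (Suc t) =
    (\<Sum>y<n. \<Sum>c<d. w x y / deg n w x * \<sigma> x y $$ (a,c) * Omega_term n d w \<sigma> y j c b t)"
proof -
  have "walk_prob n w (x # qs) * path_prod d \<sigma> (x # qs) $$ (a,b) =
      (\<Sum>c<d. w x y / deg n w x * \<sigma> x y $$ (a,c) * (walk_prob n w qs * path_prod d \<sigma> qs $$ (c,b)))"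
    if y: "y < n" and qs: "qs \<in> hit_paths n y j t" for y qs
  proof -
    obtain r where r: "qs = y # r" using qs by (rule hit_paths_start)
    have sub: "set qs \<subseteq> {..<n}" using qs by (simp add: hit_paths_def)
    show ?thesis
    \<comment> \<open>If a weight vanishes both sides are 0; otherwise all matrices have their
      proper dimensions and the product can be expanded.\<close>
    proof (cases "w x y = 0 \<or> walk_prob n w qs = 0")
      case False
      then have "0 < w x y" using w by (metis wgraph_def order_le_less)
      then have "\<sigma> x y \<in> carrier_mat d d" using s \<open>x < n\<close> y by (simp add: signature_def orth_def)
      moreover have "path_prod d \<sigma> qs \<in> carrier_mat d d"
        using path_prod_orth[OF w s sub] False by (simp add: orth_def)
      ultimately show ?thesis using assms r
        by (simp add: scalar_prod_def lessThan_atLeast0 sum_distrib_left mult_ac)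
    qed (auto simp: r)
  qed
  then have "Omega_term n d w \<sigma> x j a b (Suc t) = (\<Sum>y<n. \<Sum>qs\<in>hit_paths n y j t. \<Sum>c<d.
      w x y / deg n w x * \<sigma> x y $$ (a,c) * (walk_prob n w qs * path_prod d \<sigma> qs $$ (c,b)))"
    unfolding Omega_term_def sum_hit_paths_Suc[OF \<open>x < n\<close> \<open>x \<noteq> j\<close>] by (intro sum.cong refl) simp
  also have "\<dots> = (\<Sum>y<n. \<Sum>c<d. \<Sum>qs\<in>hit_paths n y j t.
      w x y / deg n w x * \<sigma> x y $$ (a,c) * (walk_prob n w qs * path_prod d \<sigma> qs $$ (c,b)))"
    by (intro sum.cong refl sum.swap)
  finally show ?thesis by (simp add: Omega_term_def sum_distrib_left)
qed

text \<open>Summation of the first-step recursion over t. The term at time 0 vanishes because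
  \<open>x\<close> differs from \<open>j\<close>, and the factor \<open>deg n w x\<close> clears the
  denominators of the transition probabilities.\<close>

lemma Omega_harmonic:
  assumes w: "wgraph n w" and s: "signature n d w \<sigma>"
    and "x < n" "j < n" "x \<noteq> j" "a < d" "b < d"
  shows "deg n w x * Omega n d w \<sigma> x j $$ (a,b) =
    (\<Sum>y<n. \<Sum>c<d. w x y * \<sigma> x y $$ (a,c) * Omega n d w \<sigma> y j $$ (c,b))"
proof (cases "deg n w x = 0")
  case True
  have "w x y = 0" if "y < n" for y
    using True that w by (auto simp: deg_def wgraph_def sum_nonneg_eq_0_iff)
  then show ?thesis using True by simp
next
  case False
  define D where "D = deg n w x"
  have sm: "summable (Omega_term n d w \<sigma> y j c b)" if "y < n" "c < d" for y c
    using summable_Omega[OF w s] that assms by blast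
  have "Omega_term n d w \<sigma> x j a b 0 = 0"
    using assms by (simp add: Omega_term_def hit_paths_0)
  then have "Omega n d w \<sigma> x j $$ (a,b) = (\<Sum>t. Omega_term n d w \<sigma> x j a b (Suc t))"
    using suminf_split_head[OF sm[OF \<open>x < n\<close> \<open>a < d\<close>]] assms by (simp add: Omega_index)
  also have "\<dots> = (\<Sum>y<n. \<Sum>c<d. \<Sum>t. w x y / D * \<sigma> x y $$ (a,c) * Omega_term n d w \<sigma> y j c b t)"
    unfolding Omega_term_Suc[OF w s \<open>x < n\<close> \<open>x \<noteq> j\<close> \<open>a < d\<close> \<open>b < d\<close>] D_def[symmetric]
    by (subst suminf_sum, force intro!: summable_sum summable_mult sm,
        intro sum.cong refl, subst suminf_sum) (force intro!: summable_mult sm)+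
  also have "\<dots> = (\<Sum>y<n. \<Sum>c<d. w x y / D * \<sigma> x y $$ (a,c) * Omega n d w \<sigma> y j $$ (c,b))"
    using assms by (intro sum.cong refl) (subst suminf_mult, simp_all add: sm Omega_index)
  finally have "Omega n d w \<sigma> x j $$ (a,b) = \<dots>" .
  then show ?thesis using False by (simp add: D_def sum_distrib_left)
qed

section \<open>Schur complements and the conductance matrix\<close>

text \<open>\<open>pick J\<close> enumerates \<open>J\<close> increasingly; its inverse sends an
  element to its rank, the number of smaller elements of \<open>J\<close>. Ranks are how submatrix
  positions are addressed below.\<close>

lemma sum_pick:
  assumes "finite J"
  shows "(\<Sum>q<card J. f (pick J q)) = (\<Sum>c\<in>J. f c)"
proof (rule sum.reindex_bij_witness[of _ "\<lambda>c. card {a\<in>J. a < c}" "pick J"])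
  fix c assume c: "c \<in> J"
  then have "{a\<in>J. a < c} \<subset> J" by auto
  then show "card {a\<in>J. a < c} \<in> {..<card J}" using assms by (simp add: psubset_card_mono)
  show "pick J (card {a\<in>J. a < c}) = c" using c by (rule pick_card_in_set)
qed (auto simp: card_pick_le pick_in_set_le)

lemma card_less_card:
  fixes J :: "nat set"
  assumes "finite J" "c \<in> J"
  shows "card {a\<in>J. a < c} < card J"
  using assms by (intro psubset_card_mono) auto

lemma card_bounded_subset:
  fixes I :: "nat set"
  assumes "I \<subseteq> {..<N}"
  shows "card {i. i < N \<and> i \<in> I} = card I"
  using assms by (intro arg_cong[of _ _ card]) auto

lemma submatrix_carrier:
  assumes "M \<in> carrier_mat N N" "I \<subseteq> {..<N}" "J \<subseteq> {..<N}"
  shows "submatrix M I J \<in> carrier_mat (card I) (card J)"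
  using assms by (auto simp: dim_submatrix card_bounded_subset)

lemma submatrix_pick:
  assumes "M \<in> carrier_mat N N" "I \<subseteq> {..<N}" "J \<subseteq> {..<N}" "p < card I" "q < card J"
  shows "submatrix M I J $$ (p,q) = M $$ (pick I p, pick J q)"
  using assms by (subst submatrix_index) (auto simp: card_bounded_subset)

lemma submatrix_mult_vec:
  assumes M: "M \<in> carrier_mat N N" and I: "I \<subseteq> {..<N}" and J: "J \<subseteq> {..<N}" and p: "p < card I"
  shows "(submatrix M I J *\<^sub>v vec (card J) (\<lambda>q. h (pick J q))) $ p = (\<Sum>c\<in>J. M $$ (pick I p, c) * h c)"
proof -
  have "finite J" using J finite_subset by blast
  have "(submatrix M I J *\<^sub>v vec (card J) (\<lambda>q. h (pick J q))) $ p =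
      (\<Sum>q<card J. M $$ (pick I p, pick J q) * h (pick J q))"
    using submatrix_carrier[OF M I J] p
    by (simp add: scalar_prod_def submatrix_pick[OF M I J p] flip: lessThan_atLeast0)
  then show ?thesis by (simp add: sum_pick[OF \<open>finite J\<close>, of "\<lambda>c. M $$ (pick I p, c) * h c"])
qed

text \<open>Eliminating the unknowns outside \<open>S\<close>: the Schur complement is the Dirichlet-to-Neumann map of \<open>S\<close>.\<close>
lemma schur_keep_extension:
  fixes M :: "real mat" and g :: "nat \<Rightarrow> real"
  assumes M: "M \<in> carrier_mat N N" and sym: "transpose_mat M = M" and S: "S \<subseteq> {..<N}"
    and inj: "\<And>h c. \<forall>c\<in>S. h c = 0 \<Longrightarrow>
      \<forall>r\<in>{..<N} - S. (\<Sum>c<N. M $$ (r,c) * h c) = 0 \<Longrightarrow> c \<in> {..<N} - S \<Longrightarrow> h c = 0"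
  obtains h where "\<And>c. c \<in> S \<Longrightarrow> h c = g c"
    "\<And>r. r \<in> {..<N} - S \<Longrightarrow> (\<Sum>c<N. M $$ (r,c) * h c) = 0"
    "\<And>r. r \<in> S \<Longrightarrow> (\<Sum>c<N. M $$ (r,c) * h c) =
      (\<Sum>c\<in>S. schur_keep M S $$ (card {a\<in>S. a < r}, card {a\<in>S. a < c}) * g c)"
proof -
  define T where "T = {..<N} - S"
  have T: "T \<subseteq> {..<N}" and fin: "finite S" "finite T"
    using S finite_subset[OF S] by (auto simp: T_def)
  have split: "(\<Sum>c<N. f c) = (\<Sum>c\<in>S. f c) + (\<Sum>c\<in>T. f c)" for f :: "nat \<Rightarrow> real"
    using sum.subset_diff[OF S, of f] by (simp add: T_def)
  have rk: "card {a\<in>J. a < c} < card J" "pick J (card {a\<in>J. a < c}) = c" if "finite J" "c \<in> J" for J :: "nat set" and c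
    using that card_less_card pick_card_in_set by auto
  define A B C D where "A = submatrix M S S" and "B = submatrix M S T"
    and "C = submatrix M T S" and "D = submatrix M T T"
  have A: "A \<in> carrier_mat (card S) (card S)" and B: "B \<in> carrier_mat (card S) (card T)"
    and C: "C \<in> carrier_mat (card T) (card S)" and D: "D \<in> carrier_mat (card T) (card T)"
    using submatrix_carrier[OF M] S T by (auto simp: A_def B_def C_def D_def)
  have Dsym: "transpose_mat D = D"
  proof (rule eq_matI)
    fix p q assume "p < dim_row D" "q < dim_col D"
    then have pq: "p < card T" "q < card T" using D by auto
    then have "pick T p < N" "pick T q < N" using T pick_in_set_le by blast+
    then have "M $$ (pick T p, pick T q) = M $$ (pick T q, pick T p)"
      using M by (subst sym[symmetric]) auto
    then show "transpose_mat D $$ (p,q) = D $$ (p,q)"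
      using pq D by (auto simp: D_def submatrix_pick[OF M T T])
  qed (use D in auto)
  \<comment> \<open>Extended by 0 to \<open>S\<close>, a kernel vector of \<open>D\<close> solves
    the interior equations with zero boundary values, which is the situation of the hypothesis
    \<open>inj\<close>.\<close>
  have Dinj: "v = 0\<^sub>v (card T)" if v: "v \<in> carrier_vec (card T)" and Dv: "D *\<^sub>v v = 0\<^sub>v (card T)" for v
  proof -
    define h where "h c = (if c \<in> T then v $ card {a\<in>T. a < c} else 0)" for c
    have vh: "v = vec (card T) (\<lambda>q. h (pick T q))"
      using v by (intro eq_vecI) (auto simp: h_def pick_in_set_le card_pick_le)
    have hS: "h c = 0" if "c \<in> S" for c using that by (simp add: h_def T_def)
    have hT: "(\<Sum>c<N. M $$ (r,c) * h c) = 0" if r: "r \<in> T" for r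
    proof -
      have "(\<Sum>c\<in>T. M $$ (r,c) * h c) = (D *\<^sub>v v) $ card {a\<in>T. a < r}"
        using submatrix_mult_vec[OF M T T rk(1)[OF fin(2) r], of h] rk(2)[OF fin(2) r]
        by (simp add: D_def vh[symmetric])
      also have "\<dots> = 0" using Dv rk(1)[OF fin(2) r] by simp
      finally show ?thesis using hS by (simp add: split)
    qed
    have h0: "h c = 0" if "c \<in> T" for c
      using inj[of h c] hS hT that by (simp add: T_def)
    have "h (pick T q) = 0" if "q < card T" for q using h0 pick_in_set_le[OF that] by simp
    then have "vec (card T) (\<lambda>q. h (pick T q)) = 0\<^sub>v (card T)" by (intro eq_vecI) simp_all
    then show ?thesis unfolding vh[symmetric] .
  qed
  define X where "X = pinv D"
  have X: "X \<in> carrier_mat (card T) (card T)" and DX: "D * X = 1\<^sub>m (card T)"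
    using pinv_symmetric_injective[OF D Dsym Dinj] by (auto simp: X_def)
  define gS where "gS = vec (card S) (\<lambda>q. g (pick S q))"
  have gS: "gS \<in> carrier_vec (card S)" by (simp add: gS_def)
  define u where "u = X *\<^sub>v (C *\<^sub>v gS)"
  have Cg: "C *\<^sub>v gS \<in> carrier_vec (card T)" using C gS by simp
  have u: "u \<in> carrier_vec (card T)" using X Cg by (simp add: u_def)
  \<comment> \<open>With u = D^{-1} C g, the sign makes the interior rows C g - D u vanish; the rows
    in \<open>S\<close> then give A g - B u = (A - B D^{-1} C) g.\<close>
  define h where "h c = (if c \<in> S then g c else - u $ card {a\<in>T. a < c})" for c
  have hS: "h c = g c" if "c \<in> S" for c using that by (simp add: h_def)
  have gSh: "gS = vec (card S) (\<lambda>q. h (pick S q))"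
    by (rule eq_vecI) (auto simp: gS_def h_def pick_in_set_le)
  have pickT: "pick T q \<notin> S" if "q < card T" for q using pick_in_set_le[OF that] by (simp add: T_def)
  have uh: "- u = vec (card T) (\<lambda>q. h (pick T q))"
    using u by (intro eq_vecI) (auto simp: h_def card_pick_le pickT)
  have row: "(\<Sum>c<N. M $$ (r,c) * h c) = (submatrix M J S *\<^sub>v gS) $ card {a\<in>J. a < r}
      + (submatrix M J T *\<^sub>v (- u)) $ card {a\<in>J. a < r}"
    if J: "J \<subseteq> {..<N}" "r \<in> J" for J r
  proof -
    have fJ: "finite J" using J finite_subset by blast
    note p = rk(1)[OF fJ J(2)]
    show ?thesis
      using submatrix_mult_vec[OF M J(1) S p, of h] submatrix_mult_vec[OF M J(1) T p, of h]
      by (simp add: split rk(2)[OF fJ J(2)] gSh uh)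
  qed
  have neg: "(Z *\<^sub>v (- u)) $ p = - (Z *\<^sub>v u) $ p" if "Z \<in> carrier_mat m (card T)" "p < m" for Z :: "real mat" and m p
    using that u by (simp add: scalar_prod_def sum_negf)
  show ?thesis
  proof (rule that[of h])
    show "h c = g c" if "c \<in> S" for c using hS that .
  next
    fix r assume "r \<in> {..<N} - S"
    then have r: "r \<in> T" by (simp add: T_def)
    have "D *\<^sub>v u = C *\<^sub>v gS"
      unfolding u_def using assoc_mult_mat_vec[OF D X Cg] DX Cg by simp
    then show "(\<Sum>c<N. M $$ (r,c) * h c) = 0"
      using row[OF T r] neg[OF D rk(1)[OF fin(2) r]] by (simp add: C_def D_def)
  next
    fix r assume r: "r \<in> S"
    define p where "p = card {a\<in>S. a < r}"
    have p: "p < card S" using rk(1)[OF fin(1) r] by (simp add: p_def)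
    have BXC: "B * X * C \<in> carrier_mat (card S) (card S)" using B X C by simp
    have K: "schur_keep M S = A - B * X * C"
      using M by (simp add: schur_keep_def Let_def A_def B_def C_def D_def X_def T_def)
    have Kc: "schur_keep M S \<in> carrier_mat (card S) (card S)"
      unfolding K by (rule minus_carrier_mat[OF BXC])
    have Bu: "(B * X * C) *\<^sub>v gS = B *\<^sub>v u"
      unfolding u_def using B X C gS Cg
      by (simp add: assoc_mult_mat_vec[of _ "card S" "card T" _ "card S"] assoc_mult_mat_vec[of _ "card S" "card T" _ "card T"])
    have "(\<Sum>c<N. M $$ (r,c) * h c) = (A *\<^sub>v gS) $ p - (B *\<^sub>v u) $ p"
      using row[OF S r] neg[OF B p] by (simp add: p_def A_def B_def)
    also have "\<dots> = (schur_keep M S *\<^sub>v gS) $ p"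
      unfolding Bu[symmetric] K using minus_mult_distrib_mat_vec[OF A BXC gS] p A B gS
      by simp
    also have "\<dots> = (\<Sum>q<card S. schur_keep M S $$ (p, card {a\<in>S. a < pick S q}) * g (pick S q))"
      using Kc p by (simp add: scalar_prod_def gS_def card_pick_le flip: lessThan_atLeast0)
    also have "\<dots> = (\<Sum>c\<in>S. schur_keep M S $$ (p, card {a\<in>S. a < c}) * g c)"
      by (rule sum_pick[OF fin(1)])
    finally show "(\<Sum>c<N. M $$ (r,c) * h c) =
      (\<Sum>c\<in>S. schur_keep M S $$ (card {a\<in>S. a < r}, card {a\<in>S. a < c}) * g c)" by (simp add: p_def)
  qed
qed

section \<open>Boundary value problems for an invertible connection Laplacian\<close>

lemma conn_op_row_sum:
  assumes "wgraph n w" "x < n" "a < d"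
  shows "(\<Sum>c<n*d. conn_lap n d w \<sigma> $$ (x*d+a, c) * h c) = conn_op n d w \<sigma> (\<lambda>y b. h (y*d+b)) x a"
proof -
  have "flat n d (\<lambda>y b. h (y*d+b)) $ c = h c" if "c < n*d" for c
    using that by (simp add: flat_def)
  then have "(conn_lap n d w \<sigma> *\<^sub>v flat n d (\<lambda>y b. h (y*d+b))) $ (x*d+a) =
      (\<Sum>c<n*d. conn_lap n d w \<sigma> $$ (x*d+a, c) * h c)"
    using assms conn_lap_carrier[of n d w \<sigma>] block_index(3)[OF assms(3,2)]
    by (auto simp: scalar_prod_def lessThan_atLeast0 simp del: conn_lap_carrier)
  then show ?thesis using conn_lap_mult[OF assms] by simp
qed

lemma invertible_zero_energy:
  assumes w: "wgraph n w" and s: "signature n d w \<tau>" and inv: "invertible_mat (conn_lap n d w \<tau>)"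
    and zero: "(\<Sum>x<n. \<Sum>a<d. z x a * conn_op n d w \<tau> z x a) = 0"
    and "x < n" "a < d"
  shows "z x a = 0"
proof -
  \<comment> \<open>\<open>invertible_mat\<close> does not fix the dimensions of the inverse; they
    are recovered from the two product equations.\<close>
  obtain B where B: "B * conn_lap n d w \<tau> = 1\<^sub>m (dim_row B)" and "conn_lap n d w \<tau> * B = 1\<^sub>m (n*d)"
    using inv carrier_matD[OF conn_lap_carrier[of n d w \<tau>]] by (auto simp: invertible_mat_def inverts_mat_def)
  have "dim_col (B * conn_lap n d w \<tau>) = n*d" "dim_col (conn_lap n d w \<tau> * B) = n*d"
    using \<open>conn_lap n d w \<tau> * B = _\<close> carrier_matD[OF conn_lap_carrier[of n d w \<tau>]] by auto
  then have Bc: "B \<in> carrier_mat (n*d) (n*d)" using B by auto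
  have "conn_lap n d w \<tau> *\<^sub>v flat n d z = 0\<^sub>v (n*d)"
    unfolding conn_lap_flat[OF w]
    by (rule block_vec_eqI[of _ n d])
      (auto simp: flat_index zero_energy_kernel[OF w s zero] block_index)
  then have "B * conn_lap n d w \<tau> *\<^sub>v flat n d z = 0\<^sub>v (n*d)"
    using Bc assoc_mult_mat_vec[OF Bc conn_lap_carrier flat_carrier, of w \<tau> z]
    by (auto intro!: eq_vecI simp: scalar_prod_def)
  then have "flat n d z = 0\<^sub>v (n*d)" using B Bc by simp
  then show ?thesis using flat_index[OF \<open>x < n\<close> \<open>a < d\<close>, of z] block_index(3)[OF \<open>a < d\<close> \<open>x < n\<close>] by simp
qed

lemma node_idx_mem: "c \<in> node_idx k x \<longleftrightarrow> (\<exists>a<k. c = x*k+a)"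
  by (auto simp: node_idx_def le_iff_add)

lemma sum_node_idx: "(\<Sum>c\<in>node_idx k x. f c) = (\<Sum>a<k. f (x*k+a))"
  unfolding node_idx_def using sum.shift_bounds_nat_ivl[of f 0 "x*k" k]
  by (simp add: lessThan_atLeast0 add.commute)

lemma block_eq_iff:
  fixes a b k x y :: nat
  assumes "a < k" "b < k"
  shows "x*k+a = y*k+b \<longleftrightarrow> x = y \<and> a = b"
  using assms block_index(1,2) by metis

text \<open>Explains the offset in \<open>cond_block\<close>: when j < i, the \<open>k\<close>
  indices of node \<open>j\<close> come first.\<close>

lemma node_pair_rank:
  assumes "i \<noteq> j" "a < k"
  shows "card {c \<in> node_idx k i \<union> node_idx k j. c < i*k+a} = (if i < j then 0 else k) + a"
proof (cases "i < j")
  case True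
  then have "Suc i * k \<le> j * k" by (intro mult_le_mono1) simp
  then have "{c \<in> node_idx k i \<union> node_idx k j. c < i*k+a} = {i*k..<i*k+a}"
    using assms(2) by (auto simp: node_idx_def)
  then show ?thesis using True by simp
next
  case False
  then have "Suc j * k \<le> i * k" using assms by (intro mult_le_mono1) simp
  then have "{c \<in> node_idx k i \<union> node_idx k j. c < i*k+a} = {j*k..<j*k+k} \<union> {i*k..<i*k+a}"
    and "{j*k..<j*k+k} \<inter> {i*k..<i*k+a} = {}"
    using assms(2) by (auto simp: node_idx_def)
  then show ?thesis using False by (simp add: card_Un_disjoint)
qed

text \<open>\<open>schur_keep_extension\<close> for boundary values \<open>g\<close> at
  \<open>i\<close> and 0 at \<open>j\<close>. The zero values suppress the off-diagonal block, so
  the current at \<open>i\<close> involves the diagonal block alone.\<close>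

lemma cond_block_extension:
  fixes g :: "nat \<Rightarrow> real"
  assumes w: "wgraph n w" and s: "signature n k w \<tau>" and inv: "invertible_mat (conn_lap n k w \<tau>)"
    and ij: "i < n" "j < n" "i \<noteq> j"
  obtains z where "\<And>a. a < k \<Longrightarrow> z i a = g a" "\<And>a. a < k \<Longrightarrow> z j a = 0"
    "\<And>x a. x < n \<Longrightarrow> a < k \<Longrightarrow> x \<noteq> i \<Longrightarrow> x \<noteq> j \<Longrightarrow> conn_op n k w \<tau> z x a = 0"
    "\<And>a. a < k \<Longrightarrow> conn_op n k w \<tau> z i a = (\<Sum>b<k. cond_block n k w \<tau> i j $$ (a,b) * g b)"
proof -
  define L where "L = conn_lap n k w \<tau>"
  define S where "S = node_idx k i \<union> node_idx k j"
  have L: "L \<in> carrier_mat (n*k) (n*k)" and LT: "transpose_mat L = L"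
    using conn_lap_symmetric[OF w s] by (simp_all add: L_def)
  have S: "S \<subseteq> {..<n*k}" using ij by (auto simp: S_def node_idx_mem block_index)
  have disj: "node_idx k i \<inter> node_idx k j = {}"
    using ij(3) by (auto simp: node_idx_mem block_eq_iff)
  have inS: "x*k+a \<in> S \<longleftrightarrow> x = i \<or> x = j" if "a < k" for x a
    using that by (auto simp: S_def node_idx_mem block_eq_iff)
  define g' where "g' c = (if c \<in> node_idx k i then g (c - i*k) else 0)" for c
  have inj: "h c = 0"
    if hS: "\<forall>c\<in>S. h c = 0"
      and hT: "\<forall>r\<in>{..<n*k} - S. (\<Sum>c<n*k. L $$ (r,c) * h c) = 0"
      and c: "c \<in> {..<n*k} - S" for h c
  proof -
    define z where "z = (\<lambda>y b. h (y*k+b))"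
    \<comment> \<open>On \<open>S\<close> the function vanishes and off \<open>S\<close> its current
      does, so the energy is 0.\<close>
    have "z x a * conn_op n k w \<tau> z x a = 0" if "x < n" "a < k" for x a
    proof (cases "x*k+a \<in> S")
      case False
      then have "conn_op n k w \<tau> z x a = 0"
        using bspec[OF hT, of "x*k+a"] that conn_op_row_sum[OF w that, of \<tau> h] block_index(3)[OF that(2,1)]
        by (simp add: L_def z_def)
      then show ?thesis by simp
    qed (use hS in \<open>simp add: z_def\<close>)
    then have "(\<Sum>x<n. \<Sum>a<k. z x a * conn_op n k w \<tau> z x a) = 0" by (intro sum.neutral ballI) simp
    then have z0: "z x a = 0" if "x < n" "a < k" for x a
      using invertible_zero_energy[OF w s inv] that by blast
    obtain x a where "x < n" "a < k" "c = x*k+a" using c by (auto elim: block_index_cases)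
    then show ?thesis using z0[of x a] by (simp add: z_def)
  qed
  obtain h where h1: "\<And>c. c \<in> S \<Longrightarrow> h c = g' c"
    and h2: "\<And>r. r \<in> {..<n*k} - S \<Longrightarrow> (\<Sum>c<n*k. L $$ (r,c) * h c) = 0"
    and h3: "\<And>r. r \<in> S \<Longrightarrow> (\<Sum>c<n*k. L $$ (r,c) * h c) =
      (\<Sum>c\<in>S. schur_keep L S $$ (card {a\<in>S. a < r}, card {a\<in>S. a < c}) * g' c)"
    by (rule schur_keep_extension[OF L LT S, where g = g'], erule (2) inj) blast
  show ?thesis
  proof (rule that[of "\<lambda>y b. h (y*k+b)"])
    show "h (i*k+a) = g a" if "a < k" for a
      using that h1[of "i*k+a"] by (auto simp: inS g'_def node_idx_mem)
    show "h (j*k+a) = 0" if "a < k" for a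
      using that h1[of "j*k+a"] ij by (auto simp: inS g'_def node_idx_mem block_eq_iff)
    show "conn_op n k w \<tau> (\<lambda>y b. h (y*k+b)) x a = 0" if "x < n" "a < k" "x \<noteq> i" "x \<noteq> j" for x a
      using h2[of "x*k+a"] that block_index(3)[OF that(2,1)] conn_op_row_sum[OF w that(1,2), of \<tau> h]
      by (simp add: inS L_def)
    fix a assume a: "a < k"
    define off where "off = (if i < j then 0 else k)"
    have "conn_op n k w \<tau> (\<lambda>y b. h (y*k+b)) i a =
        (\<Sum>c\<in>S. schur_keep L S $$ (card {a'\<in>S. a' < i*k+a}, card {a\<in>S. a < c}) * g' c)"
      using conn_op_row_sum[OF w ij(1) a, of \<tau> h] h3[of "i*k+a"] a by (simp add: inS L_def)
    also have "\<dots> = (\<Sum>c\<in>node_idx k i. schur_keep L S $$ (off + a, card {a\<in>S. a < c}) * g' c)"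
    proof -
      have "(\<Sum>c\<in>node_idx k j. schur_keep L S $$ (off + a, card {a\<in>S. a < c}) * g' c) = 0"
        using disj by (intro sum.neutral) (auto simp: g'_def)
      moreover have "card {a'\<in>S. a' < i*k+a} = off + a"
        using node_pair_rank[OF ij(3) a] by (simp add: S_def off_def)
      moreover have "(\<Sum>c\<in>S. f c) = (\<Sum>c\<in>node_idx k i. f c) + (\<Sum>c\<in>node_idx k j. f c)" for f :: "nat \<Rightarrow> real"
        unfolding S_def by (rule sum.union_disjoint[OF _ _ disj]) (simp_all add: node_idx_def)
      ultimately show ?thesis by simp
    qed
    also have "\<dots> = (\<Sum>b<k. schur_keep L S $$ (off + a, off + b) * g b)"
      unfolding sum_node_idx
    proof (intro sum.cong refl)
      fix b assume "b \<in> {..<k}"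
      then have b: "b < k" by simp
      have "card {a'\<in>S. a' < i*k+b} = off + b"
        using node_pair_rank[OF ij(3) b] by (simp add: S_def off_def)
      moreover have "g' (i*k+b) = g b" using b by (auto simp: g'_def node_idx_mem)
      ultimately show "schur_keep L S $$ (off + a, card {a\<in>S. a < i*k+b}) * g' (i*k+b) =
          schur_keep L S $$ (off + a, off + b) * g b" by simp
    qed
    also have "\<dots> = (\<Sum>b<k. cond_block n k w \<tau> i j $$ (a,b) * g b)"
      using a by (simp add: cond_block_def cond_mat_def Let_def off_def L_def S_def)
    finally show "conn_op n k w \<tau> (\<lambda>y b. h (y*k+b)) i a = (\<Sum>b<k. cond_block n k w \<tau> i j $$ (a,b) * g b)" .
  qed
qed

text \<open>If C_ii v = 0, the extension of \<open>v\<close> has zero energy and is therefore 0, so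
  C_ii is invertible. Taking column \<open>c\<close> of the inverse as boundary value at
  \<open>i\<close> then produces the unit current in component \<open>c\<close>.\<close>

lemma cond_block_potential:
  assumes w: "wgraph n w" and s: "signature n k w \<tau>" and inv: "invertible_mat (conn_lap n k w \<tau>)"
    and ij: "i < n" "j < n" "i \<noteq> j"
  shows "minv (cond_block n k w \<tau> i j) \<in> carrier_mat k k"
    and "c < k \<Longrightarrow> \<exists>z. (\<forall>a<k. z i a = minv (cond_block n k w \<tau> i j) $$ (a,c)) \<and> (\<forall>a<k. z j a = 0) \<and>
      (\<forall>x<n. \<forall>a<k. x \<noteq> j \<longrightarrow> conn_op n k w \<tau> z x a = (if x = i \<and> a = c then 1 else 0))"
proof -
  define C where "C = cond_block n k w \<tau> i j"
  have C: "C \<in> carrier_mat k k" by (simp add: C_def cond_block_def Let_def)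
  have inj: "v = 0\<^sub>v k" if v: "v \<in> carrier_vec k" and Cv: "C *\<^sub>v v = 0\<^sub>v k" for v
  proof -
    obtain z where z: "\<And>a. a < k \<Longrightarrow> z i a = v $ a" "\<And>a. a < k \<Longrightarrow> z j a = 0"
      "\<And>x a. x < n \<Longrightarrow> a < k \<Longrightarrow> x \<noteq> i \<Longrightarrow> x \<noteq> j \<Longrightarrow> conn_op n k w \<tau> z x a = 0"
      "\<And>a. a < k \<Longrightarrow> conn_op n k w \<tau> z i a = (\<Sum>b<k. C $$ (a,b) * v $ b)"
      by (rule cond_block_extension[OF w s inv ij, of "\<lambda>a. v $ a", folded C_def]) blast
    have "(\<Sum>b<k. C $$ (a,b) * v $ b) = (C *\<^sub>v v) $ a" if "a < k" for a
      using that C v by (simp add: scalar_prod_def lessThan_atLeast0)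
    then have "conn_op n k w \<tau> z i a = 0" if "a < k" for a using z(4) Cv that by simp
    then have "z x a * conn_op n k w \<tau> z x a = 0" if "x < n" "a < k" for x a
      using z(2,3) that by (cases "x = i"; cases "x = j") auto
    then have "(\<Sum>x<n. \<Sum>a<k. z x a * conn_op n k w \<tau> z x a) = 0" by (intro sum.neutral ballI) simp
    then have "z i a = 0" if "a < k" for a
      using invertible_zero_energy[OF w s inv] ij that by blast
    then show ?thesis using z(1) v by (intro eq_vecI) auto
  qed
  have G: "minv C \<in> carrier_mat k k" and CG: "C * minv C = 1\<^sub>m k"
    using minv_injective[OF C inj] by auto
  show "minv (cond_block n k w \<tau> i j) \<in> carrier_mat k k" using G by (simp add: C_def)
  assume c: "c < k"
  obtain z where z: "\<And>a. a < k \<Longrightarrow> z i a = minv C $$ (a,c)" "\<And>a. a < k \<Longrightarrow> z j a = 0"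
      "\<And>x a. x < n \<Longrightarrow> a < k \<Longrightarrow> x \<noteq> i \<Longrightarrow> x \<noteq> j \<Longrightarrow> conn_op n k w \<tau> z x a = 0"
      "\<And>a. a < k \<Longrightarrow> conn_op n k w \<tau> z i a = (\<Sum>b<k. C $$ (a,b) * minv C $$ (b,c))"
    by (rule cond_block_extension[OF w s inv ij, of "\<lambda>a. minv C $$ (a,c)", folded C_def]) blast
  have "(\<Sum>b<k. C $$ (a,b) * minv C $$ (b,c)) = (if a = c then 1 else 0)" if a: "a < k" for a
  proof -
    have "(C * minv C) $$ (a,c) = (\<Sum>b<k. C $$ (a,b) * minv C $$ (b,c))"
      using a c C G by (simp add: scalar_prod_def lessThan_atLeast0)
    then show ?thesis using a c CG by simp
  qed
  then have "conn_op n k w \<tau> z x a = (if x = i \<and> a = c then 1 else 0)" if "x < n" "a < k" "x \<noteq> j" for x a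
    using z(3,4) that by (cases "x = i") simp_all
  then show "\<exists>z. (\<forall>a<k. z i a = minv (cond_block n k w \<tau> i j) $$ (a,c)) \<and> (\<forall>a<k. z j a = 0) \<and>
      (\<forall>x<n. \<forall>a<k. x \<noteq> j \<longrightarrow> conn_op n k w \<tau> z x a = (if x = i \<and> a = c then 1 else 0))"
    using z(1,2) unfolding C_def by blast
qed

section \<open>Potentials and the resistance formula\<close>

text \<open>Makes symmetry and the energy argument available for the scalar Laplacian, as the case
  of the trivial one-dimensional signature.\<close>

lemma graph_lap_conn_lap:
  assumes "wgraph n w"
  shows "graph_lap n w = conn_lap n 1 w (\<lambda>_ _. 1\<^sub>m 1)"
proof (rule eq_matI)
  fix x y assume "x < dim_row (conn_lap n 1 w (\<lambda>_ _. 1\<^sub>m 1))" "y < dim_col (conn_lap n 1 w (\<lambda>_ _. 1\<^sub>m 1))"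
  then have xy: "x < n" "y < n" by (simp_all add: conn_lap_def)
  then show "graph_lap n w $$ (x,y) = conn_lap n 1 w (\<lambda>_ _. 1\<^sub>m 1) $$ (x,y)"
    using conn_lap_index[OF assms xy(1) _ xy(2), of 0 1 0 "\<lambda>_ _. 1\<^sub>m 1"]
    by (simp add: graph_lap_def)
qed (simp_all add: graph_lap_def conn_lap_def)

lemma trivial_signature: "signature n d w (\<lambda>_ _. 1\<^sub>m d)"
  by (simp add: signature_def orth_def)

lemma conn_op_trivial_1:
  "conn_op n 1 w (\<lambda>_ _. 1\<^sub>m 1) z x 0 = deg n w x * z x 0 - (\<Sum>y<n. w x y * z y 0)"
  by (simp add: conn_op_def)

text \<open>For the trivial signature, parallel along an edge means equal at its ends; connectedness
  propagates equality to all nodes.\<close>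

lemma graph_lap_kernel_constant:
  assumes w: "wgraph n w" and v: "v \<in> carrier_vec n" and ker: "graph_lap n w *\<^sub>v v = 0\<^sub>v n"
    and "x < n" "y < n"
  shows "v $ x = v $ y"
proof -
  let ?\<iota> = "\<lambda>_ _. 1\<^sub>m 1 :: real mat"
  define z where "z = (\<lambda>x (a::nat). v $ (x*1+a))"
  have fz: "flat n 1 z = v" unfolding z_def by (rule flat_unflat) (simp add: v)
  have "flat n 1 (conn_op n 1 w ?\<iota> z) = 0\<^sub>v n"
    using ker unfolding graph_lap_conn_lap[OF w] conn_lap_flat[OF w, of 1 ?\<iota> z, unfolded fz] .
  then have "conn_op n 1 w ?\<iota> z x a = 0" if "x < n" "a < 1" for x a
    using flat_index[OF that, of "conn_op n 1 w ?\<iota> z"] that by simp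
  then have zero: "(\<Sum>x<n. \<Sum>a<1. z x a * conn_op n 1 w ?\<iota> z x a) = 0"
    by (intro sum.neutral ballI) simp
  have step: "v $ a = v $ b" if "a < n \<and> b < n \<and> 0 < w a b" for a b
    using zero_energy_parallel[OF w trivial_signature zero, of a b 0] that by (simp add: z_def)
  have "(\<lambda>a b. a < n \<and> b < n \<and> 0 < w a b)\<^sup>*\<^sup>* x y"
    using w assms(4,5) by (simp add: wgraph_def)
  then show ?thesis by (induction rule: rtranclp_induct) (simp, metis step)
qed

lemma eff_res_commute:
  assumes w: "wgraph n w"
  shows "eff_res n w j i = eff_res n w i j"
proof -
  define A where "A = graph_lap n w"
  have A: "A \<in> carrier_mat n n" by (simp add: A_def graph_lap_def)
  have AT: "transpose_mat A = A"
    using conn_lap_symmetric[OF w trivial_signature] by (simp add: A_def graph_lap_conn_lap[OF w])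
  have X: "pinv A \<in> carrier_mat n n"
    using pinv_symmetric[OF A AT] A by (simp add: is_pinv_def)
  define e :: "real vec" where "e = unit_vec n i - unit_vec n j"
  have e: "e \<in> carrier_vec n" and Xe: "pinv A *\<^sub>v e \<in> carrier_vec n"
    using X by (simp_all add: e_def)
  have "unit_vec n j - unit_vec n i = (- 1) \<cdot>\<^sub>v e"
    by (rule eq_vecI) (simp_all add: e_def)
  then show ?thesis
    using e Xe by (simp add: eff_res_def Let_def mult_mat_vec[OF X e] flip: A_def e_def)
qed

text \<open>The vector e = e_i - e_j is orthogonal to the constants, so u = L^+ e solves L u = e.
  Subtracting the constant u(j), which L annihilates, grounds the potential at \<open>j\<close> and
  leaves u(i) - u(j), the effective resistance, at \<open>i\<close>.\<close>

lemma graph_potential: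
  assumes w: "wgraph n w" and ij: "i < n" "j < n" "i \<noteq> j"
  obtains v where "v j = 0" "v i = eff_res n w i j"
    "\<And>x. x < n \<Longrightarrow> x \<noteq> j \<Longrightarrow> deg n w x * v x - (\<Sum>y<n. w x y * v y) = (if x = i then 1 else 0)"
proof -
  let ?\<iota> = "\<lambda>_ _. 1\<^sub>m 1 :: real mat"
  define A where "A = graph_lap n w"
  define e :: "real vec" where "e = unit_vec n i - unit_vec n j"
  define u where "u = pinv A *\<^sub>v e"
  have A: "A \<in> carrier_mat n n" by (simp add: A_def graph_lap_def)
  have AT: "transpose_mat A = A"
    using conn_lap_symmetric[OF w trivial_signature] by (simp add: A_def graph_lap_conn_lap[OF w])
  have e: "e \<in> carrier_vec n" by (simp add: e_def)
  have ve: "v \<bullet> e = v $ i - v $ j" if "v \<in> carrier_vec n" for v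
    using that ij by (simp add: e_def scalar_prod_minus_distrib[of _ n] scalar_prod_right_unit)
  have Au: "A *\<^sub>v u = e" unfolding u_def
  proof (rule pinv_solves[OF A AT e])
    fix v assume "v \<in> carrier_vec n" "A *\<^sub>v v = 0\<^sub>v n"
    then show "v \<bullet> e = 0"
      using graph_lap_kernel_constant[OF w, of v i j] ij by (simp add: ve A_def)
  qed
  have u: "u \<in> carrier_vec n"
    using pinv_symmetric[OF A AT] A by (auto simp: u_def is_pinv_def intro!: carrier_vecI)
  have res: "eff_res n w i j = u $ i - u $ j"
    using comm_scalar_prod[OF e u] ve[OF u]
    by (simp add: eff_res_def Let_def u_def A_def e_def)
  have harm: "deg n w x * u $ x - (\<Sum>y<n. w x y * u $ y) = e $ x" if "x < n" for x
  proof -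
    have "flat n 1 (\<lambda>y b. u $ (y*1+b)) = u" by (rule flat_unflat) (simp add: u)
    then show ?thesis
      using conn_lap_mult[OF w that, of 0 1 ?\<iota> "\<lambda>y b. u $ (y*1+b)"] Au
      by (simp add: A_def graph_lap_conn_lap[OF w] conn_op_trivial_1[unfolded One_nat_def])
  qed
  show ?thesis
  proof (rule that[of "\<lambda>x. u $ x - u $ j"])
    fix x assume x: "x < n" "x \<noteq> j"
    have "deg n w x * (u $ x - u $ j) - (\<Sum>y<n. w x y * (u $ y - u $ j)) = e $ x"
      unfolding harm[OF x(1), symmetric]
      by (simp add: deg_def algebra_simps sum_subtractf sum_distrib_left sum_distrib_right)
    then show "deg n w x * (u $ x - u $ j) - (\<Sum>y<n. w x y * (u $ y - u $ j)) = (if x = i then 1 else 0)"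
      using x ij by (simp add: e_def)
  qed (simp_all add: res)
qed

section \<open>Potentials under direct sums and gauge transformations\<close>

lemma triv_plus_index:
  assumes "\<tau> x y \<in> carrier_mat k k" "a < \<rho> + k" "b < \<rho> + k"
  shows "triv_plus \<rho> k \<tau> x y $$ (a,b) = (if a < \<rho> then if a = b then 1 else 0
    else if b < \<rho> then 0 else \<tau> x y $$ (a - \<rho>, b - \<rho>))"
  using assms by (auto simp: triv_plus_def)

lemma sum_lessThan_split: "(\<Sum>c<\<rho>+k. f c) = (\<Sum>c<\<rho>. f c) + (\<Sum>c<k. f (\<rho> + c))" for f :: "nat \<Rightarrow> real"
  using sum.atLeastLessThan_concat[of 0 \<rho> "\<rho>+k" f] sum.shift_bounds_nat_ivl[of f 0 \<rho> k]
  by (simp add: lessThan_atLeast0 add.commute)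

lemma conn_op_triv_plus:
  assumes w: "wgraph n w" and s: "signature n k w \<tau>" and "x < n" "a < \<rho> + k"
  shows "conn_op n (\<rho> + k) w (triv_plus \<rho> k \<tau>) z x a =
    (if a < \<rho> then deg n w x * z x a - (\<Sum>y<n. w x y * z y a)
     else conn_op n k w \<tau> (\<lambda>x c. z x (\<rho> + c)) x (a - \<rho>))"
proof -
  have "(\<Sum>b<\<rho>+k. w x y * triv_plus \<rho> k \<tau> x y $$ (a,b) * z y b) =
      (if a < \<rho> then w x y * z y a else (\<Sum>b<k. w x y * \<tau> x y $$ (a - \<rho>, b) * z y (\<rho> + b)))"
    if "y < n" for y
  proof (cases "w x y = 0")
    case False
    then have "0 < w x y" using w by (metis wgraph_def order_le_less)
    then have "\<tau> x y \<in> carrier_mat k k" using s that assms(3) by (simp add: signature_def orth_def)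
    note idx = triv_plus_index[where \<tau> = \<tau>, OF this assms(4)]
    have 1: "(\<Sum>b<\<rho>. w x y * triv_plus \<rho> k \<tau> x y $$ (a,b) * z y b) =
        (\<Sum>b<\<rho>. if a = b then w x y * z y b else 0)"
      by (intro sum.cong refl) (auto simp: idx)
    have 2: "(\<Sum>b<k. w x y * triv_plus \<rho> k \<tau> x y $$ (a,\<rho>+b) * z y (\<rho>+b)) =
        (\<Sum>b<k. if a < \<rho> then 0 else w x y * \<tau> x y $$ (a - \<rho>, b) * z y (\<rho> + b))"
      by (intro sum.cong refl) (auto simp: idx)
    show ?thesis unfolding sum_lessThan_split 1 2 by simp
  qed simp
  then show ?thesis using assms(4) by (simp add: conn_op_def)
qed

text \<open>\<open>U b\<close> is column \<open>b\<close> of the matrix potential. The operator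
  decouples, so a trivial column is the scalar potential placed in component \<open>b\<close>, and
  the other columns come from \<tau>.\<close>

lemma triv_plus_potential:
  assumes w: "wgraph n w" and s: "signature n k w \<tau>" and inv: "invertible_mat (conn_lap n k w \<tau>)"
    and ij: "i < n" "j < n" "i \<noteq> j"
  obtains U where "\<And>b a. b < \<rho> + k \<Longrightarrow> a < \<rho> + k \<Longrightarrow> U b j a = 0"
    "\<And>b x a. b < \<rho> + k \<Longrightarrow> x < n \<Longrightarrow> a < \<rho> + k \<Longrightarrow> x \<noteq> j \<Longrightarrow>
      conn_op n (\<rho> + k) w (triv_plus \<rho> k \<tau>) (U b) x a = (if x = i \<and> a = b then 1 else 0)"
    "(\<Sum>b<\<rho>+k. U b i b) = real \<rho> * eff_res n w i j + mtrace (minv (cond_block n k w \<tau> i j))"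
proof -
  define G where "G = minv (cond_block n k w \<tau> i j)"
  have G: "G \<in> carrier_mat k k" unfolding G_def by (rule cond_block_potential(1)[OF w s inv ij])
  obtain v where v: "v j = 0" "v i = eff_res n w i j"
    "\<And>x. x < n \<Longrightarrow> x \<noteq> j \<Longrightarrow> deg n w x * v x - (\<Sum>y<n. w x y * v y) = (if x = i then 1 else 0)"
    by (rule graph_potential[OF w ij]) blast
  define P where "P c z \<longleftrightarrow> (\<forall>a<k. z i a = G $$ (a,c)) \<and> (\<forall>a<k. z j a = 0) \<and>
      (\<forall>x<n. \<forall>a<k. x \<noteq> j \<longrightarrow> conn_op n k w \<tau> z x a = (if x = i \<and> a = c then 1 else 0))" for c z
  have "\<forall>c<k. \<exists>z. P c z"
    unfolding P_def G_def using cond_block_potential(2)[OF w s inv ij] by blast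
  then obtain Z where PZ: "\<And>c. c < k \<Longrightarrow> P c (Z c)" by metis
  have Z: "\<And>c a. c < k \<Longrightarrow> a < k \<Longrightarrow> Z c i a = G $$ (a,c)"
    "\<And>c a. c < k \<Longrightarrow> a < k \<Longrightarrow> Z c j a = 0"
    "\<And>c x a. c < k \<Longrightarrow> x < n \<Longrightarrow> a < k \<Longrightarrow> x \<noteq> j \<Longrightarrow> conn_op n k w \<tau> (Z c) x a = (if x = i \<and> a = c then 1 else 0)"
    using PZ unfolding P_def by blast+
  define U where "U b x a = (if b < \<rho> then if a = b then v x else 0
    else if a < \<rho> then 0 else Z (b - \<rho>) x (a - \<rho>))" for b x a
  show ?thesis
  proof (rule that[of U])
    show "U b j a = 0" if "b < \<rho> + k" "a < \<rho> + k" for b a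
      using that v(1) Z(2)[of "b - \<rho>" "a - \<rho>"] by (auto simp: U_def)
    show "conn_op n (\<rho> + k) w (triv_plus \<rho> k \<tau>) (U b) x a = (if x = i \<and> a = b then 1 else 0)"
      if "b < \<rho> + k" "x < n" "a < \<rho> + k" "x \<noteq> j" for b x a
    proof (cases "b < \<rho>")
      case True
      have "conn_op n k w \<tau> (\<lambda>x c. U b x (\<rho> + c)) x (a - \<rho>) = 0"
        using True by (simp add: conn_op_def U_def)
      then show ?thesis
        unfolding conn_op_triv_plus[OF w s that(2,3)] using True v(3)[OF that(2,4)]
        by (auto simp: U_def)
    next
      case False
      then have "(\<lambda>x c. U b x (\<rho> + c)) = Z (b - \<rho>)" by (simp add: U_def)
      then show ?thesis
        unfolding conn_op_triv_plus[OF w s that(2,3)] using False that Z(3)[of "b - \<rho>" x "a - \<rho>"]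
        by (auto simp: U_def)
    qed
    show "(\<Sum>b<\<rho>+k. U b i b) = real \<rho> * eff_res n w i j + mtrace (minv (cond_block n k w \<tau> i j))"
      unfolding sum_lessThan_split G_def[symmetric] using G by (simp add: U_def v(2) Z(1) mtrace_def)
  qed
qed

lemma conn_op_sum:
  "conn_op n d w \<sigma> (\<lambda>x a. \<Sum>e\<in>E. g e * U e x a) x a = (\<Sum>e\<in>E. g e * conn_op n d w \<sigma> (U e) x a)"
proof -
  have "(\<Sum>y<n. \<Sum>b<d. w x y * \<sigma> x y $$ (a,b) * (\<Sum>e\<in>E. g e * U e y b)) =
      (\<Sum>y<n. \<Sum>b<d. \<Sum>e\<in>E. g e * (w x y * \<sigma> x y $$ (a,b) * U e y b))"
    by (simp add: sum_distrib_left mult_ac)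
  also have "\<dots> = (\<Sum>y<n. \<Sum>e\<in>E. \<Sum>b<d. g e * (w x y * \<sigma> x y $$ (a,b) * U e y b))"
    by (intro sum.cong refl sum.swap)
  also have "\<dots> = (\<Sum>e\<in>E. \<Sum>y<n. \<Sum>b<d. g e * (w x y * \<sigma> x y $$ (a,b) * U e y b))"
    by (rule sum.swap)
  finally show ?thesis
    by (simp add: conn_op_def right_diff_distrib sum_subtractf sum_distrib_left mult_ac)
qed

text \<open>The relation F S = T H multiplied by the transpose of \<open>F\<close> on the left and
  that of \<open>H\<close> on the right, read entrywise.\<close>

lemma gauge_intertwines:
  assumes f: "orth d F" "orth d H" and S: "orth d S" and T: "T \<in> carrier_mat d d"
    and eq: "F * S = T * H" and "a < d" "b < d"
  shows "(\<Sum>c<d. S $$ (a,c) * H $$ (b,c)) = (\<Sum>c<d. F $$ (c,a) * T $$ (c,b))"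
proof -
  have c: "F \<in> carrier_mat d d" "H \<in> carrier_mat d d" "S \<in> carrier_mat d d"
    "transpose_mat F \<in> carrier_mat d d" "transpose_mat H \<in> carrier_mat d d"
    using f S by (auto simp: orth_def)
  have FF: "transpose_mat F * F = 1\<^sub>m d" and HH: "H * transpose_mat H = 1\<^sub>m d"
    using orth_transpose[OF f(1)] f(2) by (auto simp: orth_def)
  have "S * transpose_mat H = (transpose_mat F * F) * S * transpose_mat H" using FF c by simp
  also have "\<dots> = transpose_mat F * (F * S) * transpose_mat H"
    using c by (simp add: square_mat_simps[where n = d])
  also have "\<dots> = transpose_mat F * T * (H * transpose_mat H)"
    unfolding eq using c T by (simp add: square_mat_simps[where n = d])
  also have "\<dots> = transpose_mat F * T" using HH c T by simp
  finally have "(S * transpose_mat H) $$ (a,b) = (transpose_mat F * T) $$ (a,b)" by simp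
  then show ?thesis using c T assms(6,7) by (simp add: scalar_prod_def lessThan_atLeast0)
qed

text \<open>Multiplying pointwise by the transpose of \<open>f x\<close> intertwines the two
  connection Laplacians; the degree term commutes with it since it is scalar at each node.\<close>

lemma conn_op_gauge:
  assumes w: "wgraph n w" and s: "signature n d w \<sigma>" and s': "\<And>x y. x < n \<Longrightarrow> y < n \<Longrightarrow> 0 < w x y \<Longrightarrow> \<tau> x y \<in> carrier_mat d d"
    and f: "\<And>x. x < n \<Longrightarrow> orth d (f x)"
    and eq: "\<And>x y. x < n \<Longrightarrow> y < n \<Longrightarrow> 0 < w x y \<Longrightarrow> f x * \<sigma> x y = \<tau> x y * f y"
    and "x < n" "a < d"
  shows "conn_op n d w \<sigma> (\<lambda>x a. \<Sum>b<d. f x $$ (b,a) * z x b) x a =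
    (\<Sum>b<d. f x $$ (b,a) * conn_op n d w \<tau> z x b)"
proof -
  have "(\<Sum>c<d. w x y * \<sigma> x y $$ (a,c) * (\<Sum>b<d. f y $$ (b,c) * z y b)) =
      (\<Sum>c<d. f x $$ (c,a) * (\<Sum>b<d. w x y * \<tau> x y $$ (c,b) * z y b))" if y: "y < n" for y
  proof (cases "w x y = 0")
    case False
    then have e: "0 < w x y" using w by (metis wgraph_def order_le_less)
    then have S: "orth d (\<sigma> x y)" using s \<open>x < n\<close> y by (simp add: signature_def)
    have "(\<Sum>c<d. w x y * \<sigma> x y $$ (a,c) * (\<Sum>b<d. f y $$ (b,c) * z y b)) =
        (\<Sum>b<d. w x y * z y b * (\<Sum>c<d. \<sigma> x y $$ (a,c) * f y $$ (b,c)))"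
      unfolding sum_distrib_left by (subst sum.swap) (simp add: mult_ac)
    also have "\<dots> = (\<Sum>b<d. w x y * z y b * (\<Sum>c<d. f x $$ (c,a) * \<tau> x y $$ (c,b)))"
      using gauge_intertwines[OF f[OF \<open>x < n\<close>] f[OF y] S s'[OF \<open>x < n\<close> y e] eq[OF \<open>x < n\<close> y e] \<open>a < d\<close>]
      by (intro sum.cong refl) simp
    also have "\<dots> = (\<Sum>c<d. f x $$ (c,a) * (\<Sum>b<d. w x y * \<tau> x y $$ (c,b) * z y b))"
      unfolding sum_distrib_left by (subst sum.swap) (simp add: mult_ac)
    finally show ?thesis .
  qed simp
  then have "(\<Sum>y<n. \<Sum>c<d. w x y * \<sigma> x y $$ (a,c) * (\<Sum>b<d. f y $$ (b,c) * z y b)) =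
      (\<Sum>y<n. \<Sum>c<d. f x $$ (c,a) * (\<Sum>b<d. w x y * \<tau> x y $$ (c,b) * z y b))"
    by (rule sum.cong[OF refl]) simp
  also have "\<dots> = (\<Sum>c<d. f x $$ (c,a) * (\<Sum>y<n. \<Sum>b<d. w x y * \<tau> x y $$ (c,b) * z y b))"
    by (subst sum.swap) (simp add: sum_distrib_left)
  finally show ?thesis
    by (simp add: conn_op_def right_diff_distrib sum_subtractf sum_distrib_left[of "deg n w x"] mult.left_commute)
qed

lemma conn_potential:
  assumes w: "wgraph n w" and s: "signature n (\<rho> + k) w \<sigma>"
    and t: "signature n k w \<tau>" and inv: "invertible_mat (conn_lap n k w \<tau>)"
    and equiv: "sig_equiv n (\<rho> + k) w \<sigma> (triv_plus \<rho> k \<tau>)"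
    and ij: "i < n" "j < n" "i \<noteq> j"
  obtains V where "\<And>c a. c < \<rho> + k \<Longrightarrow> a < \<rho> + k \<Longrightarrow> V c j a = 0"
    "\<And>c x a. c < \<rho> + k \<Longrightarrow> x < n \<Longrightarrow> a < \<rho> + k \<Longrightarrow> x \<noteq> j \<Longrightarrow>
      conn_op n (\<rho> + k) w \<sigma> (V c) x a = (if x = i \<and> a = c then 1 else 0)"
    "(\<Sum>c<\<rho>+k. V c i c) = real \<rho> * eff_res n w i j + mtrace (minv (cond_block n k w \<tau> i j))"
proof -
  define d where "d = \<rho> + k"
  obtain U where U: "\<And>b a. b < d \<Longrightarrow> a < d \<Longrightarrow> U b j a = 0"
    "\<And>b x a. b < d \<Longrightarrow> x < n \<Longrightarrow> a < d \<Longrightarrow> x \<noteq> j \<Longrightarrow>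
      conn_op n d w (triv_plus \<rho> k \<tau>) (U b) x a = (if x = i \<and> a = b then 1 else 0)"
    "(\<Sum>b<d. U b i b) = real \<rho> * eff_res n w i j + mtrace (minv (cond_block n k w \<tau> i j))"
    by (rule triv_plus_potential[OF w t inv ij, of \<rho>, folded d_def]) blast
  obtain f where f: "\<And>x. x < n \<Longrightarrow> orth d (f x)"
    "\<And>x y. x < n \<Longrightarrow> y < n \<Longrightarrow> 0 < w x y \<Longrightarrow> f x * \<sigma> x y = triv_plus \<rho> k \<tau> x y * f y"
    using equiv unfolding sig_equiv_def d_def by blast
  have tc: "triv_plus \<rho> k \<tau> x y \<in> carrier_mat d d" if "x < n" "y < n" "0 < w x y" for x y
    using t that by (auto simp: triv_plus_def d_def signature_def orth_def)
  \<comment> \<open>As matrices, V(x) = f(x)^T U(x) f(i). The left factor is the gauge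
    transformation; the constant right factor f(i) turns the current f(i)^T at \<open>i\<close> back
    into the identity.\<close>
  define Y where "Y c x b = (\<Sum>e<d. f i $$ (e,c) * U e x b)" for c x b
  define V where "V c x a = (\<Sum>b<d. f x $$ (b,a) * Y c x b)" for c x a
  show ?thesis
  proof (rule that[of V], unfold d_def[symmetric])
    show "V c j a = 0" if "c < d" "a < d" for c a
      using that by (simp add: V_def Y_def U(1))
    show "conn_op n d w \<sigma> (V c) x a = (if x = i \<and> a = c then 1 else 0)"
      if "c < d" "x < n" "a < d" "x \<noteq> j" for c x a
    proof -
      have "conn_op n d w \<sigma> (V c) x a = (\<Sum>b<d. f x $$ (b,a) * conn_op n d w (triv_plus \<rho> k \<tau>) (Y c) x b)"
        unfolding V_def using conn_op_gauge[OF w s[folded d_def] tc f that(2,3)] .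
      also have "\<dots> = (\<Sum>b<d. f x $$ (b,a) * (if x = i then f i $$ (b,c) else 0))"
        unfolding Y_def conn_op_sum
        by (intro sum.cong refl) (simp add: U(2) that if_distrib cong: if_cong)
      also have "\<dots> = (if x = i \<and> a = c then 1 else 0)"
        using orth_columns[OF f(1)[OF ij(1)] that(3,1)] by (cases "x = i") simp_all
      finally show ?thesis .
    qed
    \<comment> \<open>V(i) is the conjugate of U(i) by the orthogonal matrix f(i), so the traces
      agree.\<close>
    have "(\<Sum>c<d. V c i c) = (\<Sum>c<d. \<Sum>b<d. \<Sum>e<d. U e i b * (f i $$ (b,c) * f i $$ (e,c)))"
      by (simp add: V_def Y_def sum_distrib_left mult_ac)
    also have "\<dots> = (\<Sum>b<d. \<Sum>c<d. \<Sum>e<d. U e i b * (f i $$ (b,c) * f i $$ (e,c)))"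
      by (rule sum.swap)
    also have "\<dots> = (\<Sum>b<d. \<Sum>e<d. \<Sum>c<d. U e i b * (f i $$ (b,c) * f i $$ (e,c)))"
      by (intro sum.cong refl sum.swap)
    also have "\<dots> = (\<Sum>b<d. \<Sum>e<d. U e i b * (if b = e then 1 else 0))"
      by (intro sum.cong refl) (simp add: orth_rows[OF f(1)[OF ij(1)]] flip: sum_distrib_left)
    also have "\<dots> = (\<Sum>b<d. U b i b)" by (simp add: if_distrib cong: if_cong)
    finally show "(\<Sum>c<d. V c i c) = real \<rho> * eff_res n w i j + mtrace (minv (cond_block n k w \<tau> i j))"
      using U(3) by simp
  qed
qed

text \<open>Pairing the potential with the harmonic function \<open>x \<mapsto> \<Omega>\<^sub>x\<^sub>j\<close> identifies the current at \<open>j\<close>.\<close>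
lemma current_at_target:
  assumes w: "wgraph n w" and s: "signature n d w \<sigma>" and ij: "i < n" "j < n" "i \<noteq> j"
    and Vj: "\<And>a. a < d \<Longrightarrow> z j a = 0"
    and V: "\<And>x a. x < n \<Longrightarrow> a < d \<Longrightarrow> x \<noteq> j \<Longrightarrow> conn_op n d w \<sigma> z x a = (if x = i \<and> a = c then 1 else 0)"
    and "a < d" "c < d"
  shows "conn_op n d w \<sigma> z j a = - Omega n d w \<sigma> i j $$ (c,a)"
proof -
  \<comment> \<open>Column \<open>a\<close> of the harmonic function. The pairing of L u with
    \<open>z\<close> is 0, since L u vanishes off \<open>j\<close> and \<open>z\<close> vanishes at
    \<open>j\<close>. Moved to L z, it has only the contribution u(i)_c from the unit current at
    \<open>i\<close> and, as \<open>Omega\<close> at \<open>j\<close> is the identity, the current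
    (L z)(j)_a.\<close>
  define u where "u x b = Omega n d w \<sigma> x j $$ (b,a)" for x b
  have "conn_op n d w \<sigma> u x b = 0" if "x < n" "x \<noteq> j" "b < d" for x b
    using Omega_harmonic[OF w s that(1) ij(2) that(2,3) \<open>a < d\<close>] by (simp add: conn_op_def u_def)
  then have "conn_op n d w \<sigma> u x b * z x b = 0" if "x < n" "b < d" for x b
    using Vj that by (cases "x = j") auto
  then have "(\<Sum>x<n. \<Sum>b<d. conn_op n d w \<sigma> u x b * z x b) = 0"
    by (intro sum.neutral ballI) simp
  then have 0: "(\<Sum>x<n. \<Sum>b<d. u x b * conn_op n d w \<sigma> z x b) = 0"
    using conn_op_selfadjoint[OF w s] by simp
  have uj: "(\<Sum>b<d. u j b * conn_op n d w \<sigma> z j b) = conn_op n d w \<sigma> z j a"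
    using \<open>a < d\<close> by (simp add: u_def Omega_diag[OF ij(2)] if_distrib[of "\<lambda>t. t * _"] cong: if_cong)
  have ui: "(\<Sum>b<d. u i b * conn_op n d w \<sigma> z i b) = u i c"
    using \<open>c < d\<close> V[OF ij(1) _ ij(3)] by (simp add: if_distrib[of "\<lambda>t. _ * t"] cong: if_cong)
  have "(\<Sum>x<n. \<Sum>b<d. u x b * conn_op n d w \<sigma> z x b) =
      (\<Sum>x\<in>{i,j}. \<Sum>b<d. u x b * conn_op n d w \<sigma> z x b)"
    using ij V by (intro sum.mono_neutral_right) (auto intro!: sum.neutral)
  also have "\<dots> = u i c + conn_op n d w \<sigma> z j a" using ij uj ui by simp
  finally show ?thesis using 0 by (simp add: u_def)
qed

text \<open>\<open>M\<close> collects the columns \<open>V c\<close>. \<open>N\<close> is the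
  identity at \<open>i\<close>, and \<open>M\<close> vanishes at \<open>j\<close>, so N^T M equals
  V(i) and the \<open>Omega\<close> block of \<open>N\<close> contributes nothing to it.\<close>

lemma energy_trace:
  assumes w: "wgraph n w" and s: "signature n d w \<sigma>" and ij: "i < n" "j < n" "i \<noteq> j"
    and Vj: "\<And>c a. c < d \<Longrightarrow> a < d \<Longrightarrow> V c j a = 0"
    and V: "\<And>c x a. c < d \<Longrightarrow> x < n \<Longrightarrow> a < d \<Longrightarrow> x \<noteq> j \<Longrightarrow>
      conn_op n d w \<sigma> (V c) x a = (if x = i \<and> a = c then 1 else 0)"
  shows "mtrace (transpose_mat (Wmat n d w \<sigma> i j) * conn_lap n d w \<sigma> * Wmat n d w \<sigma> i j) = (\<Sum>c<d. V c i c)"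
    and "transpose_mat (Wmat n d w \<sigma> i j) * conn_lap n d w \<sigma> * Wmat n d w \<sigma> i j \<in> carrier_mat d d"
proof -
  define L where "L = conn_lap n d w \<sigma>"
  define N where "N = Nmat n d w \<sigma> i j"
  define M where "M = mat (n*d) d (\<lambda>(r,c). V c (r div d) (r mod d))"
  have L: "L \<in> carrier_mat (n*d) (n*d)" and N: "N \<in> carrier_mat (n*d) d" and M: "M \<in> carrier_mat (n*d) d"
    by (simp_all add: L_def N_def M_def Nmat_def)
  have LT: "transpose_mat L = L" using conn_lap_symmetric[OF w s] by (simp add: L_def)
  have colM: "col M c = flat n d (V c)" if "c < d" for c
    using that by (auto simp: M_def flat_def)
  have N_index: "N $$ (x*d+a, c) = (if x = i then if a = c then 1 else 0
      else if x = j then - Omega n d w \<sigma> i j $$ (c,a) else 0)"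
    if "x < n" "a < d" "c < d" for x a c
    using that block_index[OF that(2), of x] by (simp add: N_def Nmat_def Omega_def)
  have LM: "L * M = N"
  proof (rule eq_matI)
    fix r c assume "r < dim_row N" "c < dim_col N"
    then obtain x a where xa: "x < n" "a < d" "r = x*d+a" and c: "c < d"
      using N by (auto elim: block_index_cases)
    have "(L * M) $$ (r,c) = (L *\<^sub>v col M c) $ r"
      using L M c xa block_index(3)[OF xa(2,1)] by simp
    also have "\<dots> = conn_op n d w \<sigma> (V c) x a"
      unfolding L_def colM[OF c] xa(3) by (rule conn_lap_mult[OF w xa(1,2)])
    also have "\<dots> = N $$ (r,c)"
    proof (cases "x = j")
      case True
      \<comment> \<open>The entry (c,a) supplied by \<open>current_at_target\<close> is the entry
        (a,c) of the transpose in \<open>Nmat\<close>.\<close>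
      then show ?thesis
        using current_at_target[OF w s ij Vj[OF c] V[OF c] xa(2) c] N_index[OF xa(1,2) c] ij xa(3) by auto
    next
      case False
      then show ?thesis using V[OF c xa(1,2)] N_index[OF xa(1,2) c] xa(3) by auto
    qed
    finally show "(L * M) $$ (r,c) = N $$ (r,c)" .
  qed (use L M N in auto)
  define X where "X = pinv L"
  have X: "X \<in> carrier_mat (n*d) (n*d)" and LXL: "L * X * L = L"
    using pinv_symmetric[OF L LT] L by (auto simp: X_def is_pinv_def)
  define W where "W = X * N"
  have W: "W \<in> carrier_mat (n*d) d" using X N by (simp add: W_def)
  have W_eq: "Wmat n d w \<sigma> i j = W" by (simp add: Wmat_def W_def X_def L_def N_def)
  have LW: "L * W = N"
  proof -
    have "L * W = L * X * L * M"
      unfolding W_def LM[symmetric] using L X M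
      by (simp add: assoc_mult_mat[of _ "n*d" "n*d" _ "n*d"])
    then show ?thesis by (simp add: LXL LM)
  qed
  have WT: "transpose_mat W \<in> carrier_mat d (n*d)" using W by simp
  have WL: "transpose_mat W * L = transpose_mat N"
    using transpose_mult[OF L W] LT LW by simp
  \<comment> \<open>L W = L M allows the right factor \<open>W\<close> to be replaced by
    \<open>M\<close>, and W^T L = (L W)^T = N^T.\<close>
  have NM: "transpose_mat W * L * W = transpose_mat N * M"
    using assoc_mult_mat[OF WT L W] assoc_mult_mat[OF WT L M] LW LM WL by simp
  show "transpose_mat (Wmat n d w \<sigma> i j) * conn_lap n d w \<sigma> * Wmat n d w \<sigma> i j \<in> carrier_mat d d"
    unfolding W_eq L_def[symmetric] NM using N M by simp
  have "mtrace (transpose_mat W * L * W) = (\<Sum>c<d. (transpose_mat N * M) $$ (c,c))"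
    unfolding NM using N by (simp add: mtrace_def)
  also have "\<dots> = (\<Sum>c<d. \<Sum>r<n*d. N $$ (r,c) * M $$ (r,c))"
    using N M by (intro sum.cong refl) (simp add: scalar_prod_def lessThan_atLeast0)
  also have "\<dots> = (\<Sum>c<d. V c i c)"
  proof (intro sum.cong refl)
    fix c assume "c \<in> {..<d}"
    then have c: "c < d" by simp
    have "(\<Sum>r<n*d. N $$ (r,c) * M $$ (r,c)) =
        (\<Sum>x<n. \<Sum>a<d. if x = i then if a = c then V c x a else 0 else 0)"
      unfolding sum_blocks
    proof (intro sum.cong refl)
      fix x a assume "x \<in> {..<n}" "a \<in> {..<d}"
      then have xa: "x < n" "a < d" by auto
      then have "M $$ (x*d+a, c) = V c x a"
        using c by (simp add: M_def block_index)
      then show "N $$ (x*d+a, c) * M $$ (x*d+a, c) = (if x = i then if a = c then V c x a else 0 else 0)"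
        using N_index[OF xa c] Vj[OF c xa(2)] ij by auto
    qed
    also have "\<dots> = (\<Sum>x<n. if x = i then V c x c else 0)"
      using c by (intro sum.cong refl) simp
    finally show "(\<Sum>r<n*d. N $$ (r,c) * M $$ (r,c)) = V c i c" using ij by simp
  qed
  finally show "mtrace (transpose_mat (Wmat n d w \<sigma> i j) * conn_lap n d w \<sigma> * Wmat n d w \<sigma> i j) = (\<Sum>c<d. V c i c)"
    by (simp add: W_eq L_def)
qed

lemma mtrace_add:
  assumes "A \<in> carrier_mat m m" "B \<in> carrier_mat m m"
  shows "mtrace (A + B) = mtrace A + mtrace B"
  using assms by (simp add: mtrace_def sum.distrib)

theorem theorem6p10:
  fixes n d \<rho> :: nat and w :: "nat \<Rightarrow> nat \<Rightarrow> real" and \<sigma> \<tau> :: "nat \<Rightarrow> nat \<Rightarrow> real mat"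
    and i j :: nat
  assumes "wgraph n w"
    and "signature n d w \<sigma>"
    and "\<rho> = kernel_dim (conn_lap n d w \<sigma>)"
    and "1 \<le> \<rho>" and "\<rho> \<le> d"
    and "signature n (d - \<rho>) w \<tau>"
    and "invertible_mat (conn_lap n (d - \<rho>) w \<tau>)"
    and "sig_equiv n d w \<sigma> (triv_plus \<rho> (d - \<rho>) \<tau>)"
    and "i < n" and "j < n" and "i \<noteq> j"
  shows "conn_res n d w \<sigma> i j =
    real \<rho> / real d * eff_res n w i j
    + 1 / (2 * real d) * mtrace (minv (cond_block n (d - \<rho>) w \<tau> i j) + minv (cond_block n (d - \<rho>) w \<tau> j i))"
proof -
  define k where "k = d - \<rho>"
  have d: "d = \<rho> + k" using assms(5) by (simp add: k_def)
  note w = assms(1) and s = assms(2) and t = assms(6)[folded k_def] and inv = assms(7)[folded k_def]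
  have equiv: "sig_equiv n (\<rho> + k) w \<sigma> (triv_plus \<rho> k \<tau>)" and s': "signature n (\<rho> + k) w \<sigma>"
    using assms(8) s d by (simp_all flip: k_def)
  define E where "E i j = transpose_mat (Wmat n d w \<sigma> i j) * conn_lap n d w \<sigma> * Wmat n d w \<sigma> i j" for i j
  \<comment> \<open>Each direction is handled alone; symmetry of \<open>eff_res\<close> later merges
    the two scalar terms into twice \<rho> times the resistance, cancelling the 2 in 1/(2d).\<close>
  have half: "mtrace (E i j) = real \<rho> * eff_res n w i j + mtrace (minv (cond_block n k w \<tau> i j))"
    and Ec: "E i j \<in> carrier_mat d d" if ij: "i < n" "j < n" "i \<noteq> j" for i j
  proof -
    obtain V where V: "\<And>c a. c < d \<Longrightarrow> a < d \<Longrightarrow> V c j a = 0"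
      "\<And>c x a. c < d \<Longrightarrow> x < n \<Longrightarrow> a < d \<Longrightarrow> x \<noteq> j \<Longrightarrow>
        conn_op n d w \<sigma> (V c) x a = (if x = i \<and> a = c then 1 else 0)"
      "(\<Sum>c<d. V c i c) = real \<rho> * eff_res n w i j + mtrace (minv (cond_block n k w \<tau> i j))"
      by (rule conn_potential[OF w s' t inv equiv ij, folded d]) blast
    show "mtrace (E i j) = real \<rho> * eff_res n w i j + mtrace (minv (cond_block n k w \<tau> i j))"
      using energy_trace(1)[OF w s ij, of V] V by (simp add: E_def)
    show "E i j \<in> carrier_mat d d"
      using energy_trace(2)[OF w s ij, of V] V by (simp add: E_def)
  qed
  have ji: "j < n" "i < n" "j \<noteq> i" and ij: "i < n" "j < n" "i \<noteq> j" using assms(9-11) by auto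
  have "conn_res n d w \<sigma> i j = 1 / (2 * real d) * (mtrace (E i j) + mtrace (E j i))"
    unfolding mtrace_add[OF Ec[OF ij] Ec[OF ji], symmetric] by (simp add: conn_res_def E_def Let_def)
  also have "\<dots> = 1 / (2 * real d) * (2 * real \<rho> * eff_res n w i j
      + mtrace (minv (cond_block n k w \<tau> i j) + minv (cond_block n k w \<tau> j i)))"
    unfolding half[OF ij] half[OF ji] eff_res_commute[OF w, of j i]
      mtrace_add[OF cond_block_potential(1)[OF w t inv ij] cond_block_potential(1)[OF w t inv ji]]
    by simp
  finally show ?thesis using assms(4,5) by (simp add: field_simps k_def)
qed

end
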